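(* Fix $2<p<\infty$ and $d\ge1$. Suppose that $\varphi_0(z) = \sum_{j=1}^d c_j z_j$ is an arbitrary point in the unit sphere of $H^2_1(\mathbb{T}^d)$ (that is, $\sum_{j=1}^d|c_j|^2=1$) and that $c_j\neq 0$ for $j=1,2,\ldots, d$. Then $$\lim_{n\to\infty}(\mathscr{P}_p^n \varphi_0)(z) = \frac{1}{\sqrt{d}} \sum_{j=1}^d \frac{c_j}{|c_j|} z_j,$$ where $\mathscr{P}_p^n$ denotes the $n$-fold iterate of $\mathscr{P}_p$.
   Context: $\mathbb{T}^d$ is the $d$-dimensional torus with normalized Haar measure $m_d$. $H^2(\mathbb{T}^d)$ is the closed subspace of $L^2(\mathbb{T}^d)$ of functions whose Fourier coefficients $\widehat f(\alpha)=\int_{\mathbb{T}^d} f(z)\overline{z^\alpha}\,dm_d(z)$ vanish for all $\alpha\in\mathbb{Z}^d\setminus\mathbb{N}_0^d$, $\mathbb{N}_0=\{0,1,2,\ldots\}$. $H^2_1(\mathbb{T}^d)$ is its subspace of $1$-homogeneous polynomials $\sum_{j=1}^d c_jz_j$, $c_j\in\mathbb{C}$. $P$ is the Riesz projection, i.e. the orthogonal projection from $L^2(\mathbb{T}^d)$ onto $H^2(\mathbb{T}^d)$. The nonlinear operator $\mathscr{P}_p$ is defined by $$\mathscr{P}_p(\varphi) := \frac{P(|\varphi|^{p-2}\varphi)}{\|P(|\varphi|^{p-2}\varphi)\|_{H^2(\mathbb{T}^d)}};$$ it maps the unit sphere of $H^2_1(\mathbb{T}^d)$ into itself. *)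

theory Defs
  imports "HOL-Probability.Probability"
begin

text \<open>
  The torus of dimension \<open>d = CARD('d)\<close> is realised as the set of all functions
  \<open>z :: 'd \<Rightarrow> complex\<close> with \<open>cmod (z j) = 1\<close> for every \<open>j\<close>; the index type \<open>'d\<close> is finite
  (and nonempty, so \<open>d \<ge> 1\<close>). Its normalized Haar measure is the product of \<open>d\<close> copies of
  the normalized arc length on the unit circle.
\<close>

definition circle_measure :: "complex measure" where
  "circle_measure =
     distr (uniform_measure lborel {0..2 * pi}) (restrict_space borel (sphere 0 1)) cis"

definition torus_haar :: "('d::finite \<Rightarrow> complex) measure" where
  "torus_haar = (\<Pi>\<^sub>M j\<in>UNIV. circle_measure)"

lemma space_circle_measure [simp]: "space circle_measure = sphere 0 1"
  by (simp add: circle_measure_def space_restrict_space)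

lemma space_torus_haar: "space torus_haar = {z. \<forall>j. cmod (z j) = 1}"
  by (auto simp: torus_haar_def space_PiM PiE_def Pi_def)

lemma prob_space_circle_measure: "prob_space circle_measure"
proof -
  interpret U: prob_space "uniform_measure lborel {0..2 * pi}"
    by (rule prob_space_uniform_measure) simp_all
  have "cis \<in> borel_measurable (borel :: real measure)"
    by (intro borel_measurable_continuous_onI continuous_intros)
  then have "cis \<in> uniform_measure lborel {0..2 * pi} \<rightarrow>\<^sub>M restrict_space borel (sphere 0 1)"
    by (intro measurable_restrict_space2) (auto simp: measurable_def)
  then show ?thesis
    unfolding circle_measure_def by (rule U.prob_space_distr)
qed

lemma prob_space_torus_haar: "prob_space torus_haar"
  unfolding torus_haar_def
  by (intro prob_space_PiM prob_space_circle_measure)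

text \<open>
  Elements of \<open>L\<^sup>2\<close> are represented by measurable functions; two functions represent the same
  element iff they agree almost everywhere, and membership in the sets below depends only on
  the element represented.
\<close>

definition L2 :: "(('d::finite \<Rightarrow> complex) \<Rightarrow> complex) set" where
  "L2 = {f \<in> borel_measurable torus_haar. integrable torus_haar (\<lambda>z. (cmod (f z))\<^sup>2)}"

definition L2_inner ::
  "(('d::finite \<Rightarrow> complex) \<Rightarrow> complex) \<Rightarrow> (('d \<Rightarrow> complex) \<Rightarrow> complex) \<Rightarrow> complex" where
  "L2_inner f g = (LINT z|torus_haar. f z * cnj (g z))"

definition L2_norm :: "(('d::finite \<Rightarrow> complex) \<Rightarrow> complex) \<Rightarrow> real" where
  "L2_norm f = sqrt (LINT z|torus_haar. (cmod (f z))\<^sup>2)"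

definition monomial :: "('d::finite \<Rightarrow> int) \<Rightarrow> ('d \<Rightarrow> complex) \<Rightarrow> complex" where
  "monomial \<alpha> z = (\<Prod>j\<in>UNIV. z j powi \<alpha> j)"

definition fourier_coeff :: "(('d::finite \<Rightarrow> complex) \<Rightarrow> complex) \<Rightarrow> ('d \<Rightarrow> int) \<Rightarrow> complex" where
  "fourier_coeff f \<alpha> = (LINT z|torus_haar. f z * cnj (monomial \<alpha> z))"

definition H2 :: "(('d::finite \<Rightarrow> complex) \<Rightarrow> complex) set" where
  "H2 = {f \<in> L2. \<forall>\<alpha>. \<not> (\<forall>j. 0 \<le> \<alpha> j) \<longrightarrow> fourier_coeff f \<alpha> = 0}"

definition H2_1 :: "(('d::finite \<Rightarrow> complex) \<Rightarrow> complex) set" where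
  "H2_1 = {f \<in> H2. \<exists>c. AE z in torus_haar. f z = (\<Sum>j\<in>UNIV. c j * z j)}"

definition H2_1_sphere :: "(('d::finite \<Rightarrow> complex) \<Rightarrow> complex) set" where
  "H2_1_sphere = {f \<in> H2_1. L2_norm f = 1}"

text \<open>
  The orthogonal projection of \<open>f \<in> L\<^sup>2\<close> onto \<open>H\<^sup>2\<close> is the element \<open>g\<close> of \<open>H\<^sup>2\<close> with \<open>f - g\<close>
  orthogonal to \<open>H\<^sup>2\<close>. It is unique up to null sets; the choice operator only picks a
  representative, depending only on the almost-everywhere class of the measurable function \<open>f\<close>.
\<close>

definition riesz_projection ::
  "(('d::finite \<Rightarrow> complex) \<Rightarrow> complex) \<Rightarrow> ('d \<Rightarrow> complex) \<Rightarrow> complex" where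
  "riesz_projection f = (SOME g. g \<in> H2 \<and> (\<forall>h\<in>H2. L2_inner (\<lambda>z. f z - g z) h = 0))"

text \<open>
  For the exponents \<open>p > 2\<close> of interest, \<open>0 powr (p - 2) = 0\<close> agrees with the usual convention.
\<close>

definition P_op ::
  "real \<Rightarrow> (('d::finite \<Rightarrow> complex) \<Rightarrow> complex) \<Rightarrow> ('d \<Rightarrow> complex) \<Rightarrow> complex" where
  "P_op p \<phi> =
     (let u = riesz_projection (\<lambda>z. of_real (cmod (\<phi> z) powr (p - 2)) * \<phi> z)
      in (\<lambda>z. u z / of_real (L2_norm u)))"

end

theory Submission
  imports Defs
begin

text \<open>
  Write \<open>q = p - 2\<close> and \<open>\<phi> = \<Sum>\<^sub>j c\<^sub>j z\<^sub>j\<close>. Since \<open>|\<phi>|^q \<phi>\<close> is 1-homogeneous, its Riesz projection is the linear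
  form with coefficients \<open>E(|\<phi>|^q \<phi> cnj z\<^sub>j)\<close>; these have the same arguments as the \<open>c\<^sub>j\<close>, so only the
  moduli \<open>r\<^sub>j = |c\<^sub>j|\<close> move, by \<open>r \<mapsto> A(r) / |A(r)|\<close>. The map \<open>A\<close> preserves the order of the coordinates
  (because \<open>x \<mapsto> |x|^q x\<close> is monotone), and \<open>A\<^sub>i(r) / r\<^sub>i > A\<^sub>k(r) / r\<^sub>k\<close> whenever \<open>r\<^sub>i < r\<^sub>k\<close>. Hence
  \<open>min r / max r\<close> increases along the orbit, and by compactness it can only converge to 1.

  The strict inequality comes from subharmonicity of \<open>|x|^q\<close>. With \<open>v = r\<^sub>i z\<^sub>i + r\<^sub>k z\<^sub>k\<close>, \<open>w\<close> the rest of \<open>\<phi>\<close> and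
  \<open>c = Re (z\<^sub>i cnj z\<^sub>k)\<close>, rotating \<open>w\<close> against \<open>v\<close> gives
  \<open>r\<^sub>k A\<^sub>i - r\<^sub>i A\<^sub>k = (r\<^sub>k\<^sup>2 - r\<^sub>i\<^sup>2) E(c h(|w|, |v|))\<close>, where \<open>h(b, x)\<close> is the mean of
  \<open>|x + b u|^q Re (x + b u) / x\<close> over the unit circle. As \<open>|v|\<close> increases with \<open>c\<close>, and \<open>c\<close> changes sign under
  \<open>z\<^sub>k \<mapsto> - z\<^sub>k\<close>, it suffices that \<open>h\<close> is strictly increasing in \<open>x\<close>.
\<close>

subsection \<open>Circular means of powers of the modulus\<close>

text \<open>Working with the squared modulus keeps the base polynomial in \<open>x\<close>; the
  exponents \<open>m\<close> below play the role of \<open>q / 2\<close>.\<close>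

definition chord_sq :: "real \<Rightarrow> real \<Rightarrow> real \<Rightarrow> real" where
  "chord_sq b x t = x\<^sup>2 + b\<^sup>2 + 2 * x * b * cos t"

definition circ_pow :: "real \<Rightarrow> real \<Rightarrow> real \<Rightarrow> real" where
  "circ_pow m b x = integral {0..2 * pi} (\<lambda>t. chord_sq b x t powr m)"

text \<open>Up to the factor \<open>2 * pi\<close>, this is the mean of |x + b u|^(2m) Re (x + b u)
  over the unit circle. With \<open>m = q / 2\<close>, division by \<open>x\<close> gives the
  function h of the overview. An integral over an interval is used because the Leibniz rule applies
  to it.\<close>

definition circ_moment :: "real \<Rightarrow> real \<Rightarrow> real \<Rightarrow> real" where
  "circ_moment m b x = integral {0..2 * pi} (\<lambda>t. chord_sq b x t powr m * (x + b * cos t))"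

lemma chord_sq_eq_cmod: "chord_sq b x t = (cmod (of_real x + of_real b * cis t))\<^sup>2"
proof -
  have "x\<^sup>2 + b\<^sup>2 + 2 * x * b * cos t = (x + b * cos t)\<^sup>2 + (b * sin t)\<^sup>2"
    using sin_cos_squared_add[of t] by algebra
  then show ?thesis unfolding cmod_power2 chord_sq_def by simp
qed

lemma chord_sq_nonneg: "0 \<le> chord_sq b x t"
  by (simp add: chord_sq_eq_cmod)

lemma chord_sq_pos:
  assumes "\<bar>x\<bar> \<noteq> \<bar>b\<bar>"
  shows "0 < chord_sq b x t"
proof -
  have "cmod (of_real x) \<noteq> cmod (of_real b * cis t)"
    using assms by (simp add: norm_mult)
  then have "of_real x + of_real b * cis t \<noteq> 0"
    by (metis add_eq_0_iff norm_minus_cancel)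
  then show ?thesis by (simp add: chord_sq_eq_cmod)
qed

lemma continuous_on_chord_sq [continuous_intros]:
  fixes f g :: "'a::t2_space \<Rightarrow> real"
  shows "continuous_on S f \<Longrightarrow> continuous_on S g \<Longrightarrow> continuous_on S (\<lambda>u. chord_sq b (f u) (g u))"
  unfolding chord_sq_def by (intro continuous_intros)

text \<open>The alternatives are the two ways in which a real power stays continuous: a positive
  exponent, which tolerates a vanishing base, or a base without zeros. The second one serves the
  derivatives, where the exponent drops to \<open>m - 1\<close> and may be negative.\<close>

lemma continuous_on_chord_powr:
  fixes f g :: "'a::t2_space \<Rightarrow> real"
  assumes "continuous_on S f" "continuous_on S g" and "0 < m \<or> (\<forall>u\<in>S. \<bar>f u\<bar> \<noteq> \<bar>b\<bar>)"
  shows "continuous_on S (\<lambda>u. chord_sq b (f u) (g u) powr m)"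
  using assms(3)
proof
  assume "0 < m"
  then show ?thesis
    using assms(1,2) by (intro continuous_on_powr' continuous_intros) (auto simp: chord_sq_nonneg)
next
  assume *: "\<forall>u\<in>S. \<bar>f u\<bar> \<noteq> \<bar>b\<bar>"
  show ?thesis
  proof (intro continuous_on_powr continuous_intros assms(1,2) ballI)
    fix u assume "u \<in> S"
    with * have "0 < chord_sq b (f u) (g u)" by (intro chord_sq_pos) auto
    then show "chord_sq b (f u) (g u) \<noteq> 0" by simp
  qed
qed

lemma chord_powr_has_derivative:
  assumes "\<bar>x\<bar> \<noteq> \<bar>b\<bar>"
  shows "((\<lambda>x. chord_sq b x t powr m) has_real_derivative
    2 * m * (chord_sq b x t powr (m - 1) * (x + b * cos t))) (at x within U)"
proof -
  have *: "((\<lambda>x. chord_sq b x t) has_real_derivative 2 * (x + b * cos t)) (at x)"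
    unfolding chord_sq_def by (auto intro!: derivative_eq_intros simp: algebra_simps)
  show ?thesis
    unfolding chord_sq_def[symmetric]
    by (rule has_field_derivative_at_within, rule DERIV_cong[OF DERIV_fun_powr[OF * chord_sq_pos[OF assms]]]) simp
qed

text \<open>Differentiation under the integral sign. \<open>U\<close> is a convex neighbourhood
  avoiding the singular points \<open>b\<close> and \<open>- b\<close>; in use it is
  \<open>{-b<..<b}\<close> or \<open>{b<..}\<close>.\<close>

lemma circ_pow_has_derivative:
  assumes "open U" "convex U" "\<And>x. x \<in> U \<Longrightarrow> \<bar>x\<bar> \<noteq> \<bar>b\<bar>" "x \<in> U"
  shows "(circ_pow m b has_real_derivative 2 * m * circ_moment (m - 1) b x) (at x)"
proof -
  have "((\<lambda>x. integral (cbox 0 (2 * pi)) (\<lambda>t. chord_sq b x t powr m)) has_real_derivative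
      integral (cbox 0 (2 * pi)) (\<lambda>t. 2 * m * (chord_sq b x t powr (m - 1) * (x + b * cos t)))) (at x within U)"
  proof (rule leibniz_rule_field_derivative)
    show "((\<lambda>x. chord_sq b x t powr m) has_real_derivative
      2 * m * (chord_sq b y t powr (m - 1) * (y + b * cos t))) (at y within U)" if "y \<in> U" for y t
      by (rule chord_powr_has_derivative) (use assms(3) that in auto)
    show "(\<lambda>t. chord_sq b y t powr m) integrable_on cbox 0 (2 * pi)" if "y \<in> U" for y
      using assms(3) that by (intro integrable_continuous continuous_on_chord_powr continuous_intros) auto
    show "continuous_on (U \<times> cbox 0 (2 * pi))
      (\<lambda>(x, t). 2 * m * (chord_sq b x t powr (m - 1) * (x + b * cos t)))"
      unfolding case_prod_beta using assms(3)
      by (intro continuous_intros continuous_on_chord_powr) auto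
  qed (use assms in auto)
  then show ?thesis
    using assms by (simp add: circ_pow_def[abs_def] circ_moment_def at_within_open[of x U])
qed

text \<open>The integrand is the derivative of \<open>chord_sq b x t powr m * (b * sin t)\<close>,
  and \<open>sin\<close> vanishes at both ends of the period.\<close>

lemma circ_moment_by_parts:
  assumes "\<bar>x\<bar> \<noteq> \<bar>b\<bar>"
  shows "((\<lambda>t. chord_sq b x t powr m * (b * cos t)
      - 2 * m * x * (chord_sq b x t powr (m - 1) * (b * sin t)\<^sup>2)) has_integral 0) {0..2 * pi}"
proof -
  have "((\<lambda>t. chord_sq b x t powr m * (b * sin t)) has_vector_derivative
      (chord_sq b x t powr m * (b * cos t) - 2 * m * x * (chord_sq b x t powr (m - 1) * (b * sin t)\<^sup>2)))
      (at t within {0..2 * pi})" for t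
  proof -
    have "((\<lambda>t. chord_sq b x t) has_real_derivative - (2 * x * b * sin t)) (at t)"
      unfolding chord_sq_def by (auto intro!: derivative_eq_intros)
    from DERIV_mult[OF DERIV_fun_powr[OF this chord_sq_pos[OF assms], of m] DERIV_cmult[OF DERIV_sin, of b t]]
    have "((\<lambda>t. chord_sq b x t powr m * (b * sin t)) has_real_derivative
      (chord_sq b x t powr m * (b * cos t) - 2 * m * x * (chord_sq b x t powr (m - 1) * (b * sin t)\<^sup>2))) (at t)"
      by (rule DERIV_cong) (simp add: power2_eq_square algebra_simps)
    then show ?thesis
      by (simp add: has_real_derivative_iff_has_vector_derivative has_vector_derivative_at_within)
  qed
  from fundamental_theorem_of_calculus[OF _ this]
  show ?thesis by simp
qed

text \<open>This is the Laplacian in polar form. Since \<open>circ_pow (m + 1) b\<close> has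
  derivative \<open>(2 * m + 2) * circ_moment m b\<close>, the claim says that the circular mean of
  |.|^(2m+2) has Laplacian (2m+2)^2 times the circular mean of |.|^(2m). In the proof, the
  differentiated integrand differs from the target by the integrand of
  \<open>circ_moment_by_parts\<close>, whose integral is zero.\<close>

lemma times_circ_moment_has_derivative:
  assumes "open U" "convex U" "\<And>x. x \<in> U \<Longrightarrow> \<bar>x\<bar> \<noteq> \<bar>b\<bar>" "x \<in> U"
  shows "((\<lambda>x. x * circ_moment m b x) has_real_derivative (2 * m + 2) * x * circ_pow m b x) (at x)"
proof -
  let ?g = "\<lambda>x t. 2 * m * (chord_sq b x t powr (m - 1) * (x + b * cos t)) * (x + b * cos t)
        + chord_sq b x t powr m"
  have cont: "continuous_on S (\<lambda>t. chord_sq b x t powr k)" for S k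
    using assms by (intro continuous_on_chord_powr continuous_intros) auto
  have "((\<lambda>x. integral (cbox 0 (2 * pi)) (\<lambda>t. chord_sq b x t powr m * (x + b * cos t))) has_real_derivative
      integral (cbox 0 (2 * pi)) (?g x)) (at x within U)"
  proof (rule leibniz_rule_field_derivative)
    show "((\<lambda>x. chord_sq b x t powr m * (x + b * cos t)) has_real_derivative ?g y t) (at y within U)"
      if "y \<in> U" for y t
    proof -
      have "((\<lambda>x. x + b * cos t) has_real_derivative 1) (at y within U)"
        by (auto intro!: derivative_eq_intros)
      from DERIV_mult[OF chord_powr_has_derivative[OF assms(3)[OF that], of t m U] this]
      show ?thesis by (rule DERIV_cong) simp
    qed
    show "(\<lambda>t. chord_sq b y t powr m * (y + b * cos t)) integrable_on cbox 0 (2 * pi)" if "y \<in> U" for y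
      using assms(3) that by (intro integrable_continuous continuous_on_chord_powr continuous_intros) auto
    have "continuous_on (U \<times> cbox 0 (2 * pi)) (\<lambda>p. chord_sq b (fst p) (snd p) powr k)" for k
      using assms(3) by (intro continuous_on_chord_powr continuous_intros) auto
    then show "continuous_on (U \<times> cbox 0 (2 * pi)) (\<lambda>(x, t). ?g x t)"
      unfolding case_prod_beta
      by (intro continuous_on_add continuous_on_mult continuous_on_const continuous_on_cos
          continuous_on_fst continuous_on_snd continuous_on_id)
  qed (use assms in auto)
  then have "(circ_moment m b has_real_derivative integral {0..2 * pi} (?g x)) (at x)"
    using assms by (simp add: circ_moment_def[abs_def] at_within_open[of x U])
  from DERIV_mult[OF DERIV_ident this]
  have 1: "((\<lambda>x. x * circ_moment m b x) has_real_derivative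
      circ_moment m b x + integral {0..2 * pi} (?g x) * x) (at x)" by simp
  have int: "(f has_integral integral {0..2 * pi} f) {0..2 * pi}" if "continuous_on {0..2 * pi} f" for f :: "real \<Rightarrow> real"
    using integrable_continuous_interval[OF that] by (rule integrable_integral)
  have "((\<lambda>t. chord_sq b x t powr m * (x + b * cos t) + ?g x t * x) has_integral
      circ_moment m b x + integral {0..2 * pi} (?g x) * x) {0..2 * pi}"
    unfolding circ_moment_def
    by (rule has_integral_add[OF int has_integral_mult_left[OF int]])
      (intro continuous_on_add continuous_on_mult continuous_on_const continuous_on_cos
          continuous_on_id cont)+
  moreover have "((\<lambda>t. (2 * m + 2) * x * chord_sq b x t powr m + (chord_sq b x t powr m * (b * cos t)
      - 2 * m * x * (chord_sq b x t powr (m - 1) * (b * sin t)\<^sup>2))) has_integral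
      (2 * m + 2) * x * circ_pow m b x + 0) {0..2 * pi}"
    unfolding circ_pow_def using assms
    by (intro has_integral_add has_integral_mult_right[OF int] circ_moment_by_parts cont) auto
  \<comment> \<open>The two integrands agree pointwise once a factor \<open>chord_sq b x t\<close>
    of the power is split into (x + b cos t)^2 + (b sin t)^2.\<close>
  moreover have "chord_sq b x t powr m * (x + b * cos t) + ?g x t * x =
      (2 * m + 2) * x * chord_sq b x t powr m + (chord_sq b x t powr m * (b * cos t)
      - 2 * m * x * (chord_sq b x t powr (m - 1) * (b * sin t)\<^sup>2))" for t
  proof -
    have "0 < chord_sq b x t" using assms by (intro chord_sq_pos) auto
    then have "chord_sq b x t powr m = chord_sq b x t powr (m - 1) * chord_sq b x t"
      using powr_add[of "chord_sq b x t" "m - 1" 1] by simp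
    moreover have "chord_sq b x t = (x + b * cos t)\<^sup>2 + (b * sin t)\<^sup>2"
      using sin_cos_squared_add[of t] unfolding chord_sq_def by algebra
    ultimately have *: "chord_sq b x t powr m =
      chord_sq b x t powr (m - 1) * (x + b * cos t)\<^sup>2 + chord_sq b x t powr (m - 1) * (b * sin t)\<^sup>2"
      by (metis distrib_left)
    show ?thesis
      by (simp add: * power2_eq_square algebra_simps)
  qed
  ultimately have "circ_moment m b x + integral {0..2 * pi} (?g x) * x = (2 * m + 2) * x * circ_pow m b x"
    by (simp add: has_integral_unique)
  with 1 show ?thesis by simp
qed

lemma continuous_on_circ_pow: "0 < m \<Longrightarrow> continuous_on S (circ_pow m b)"
  unfolding circ_pow_def[abs_def]
  by (rule integral_continuous_on_param[of S 0 "2 * pi" "\<lambda>x t. chord_sq b x t powr m",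
        unfolded case_prod_beta cbox_interval])
    (intro continuous_intros continuous_on_chord_powr; simp)

lemma continuous_on_circ_moment: "0 < m \<Longrightarrow> continuous_on S (circ_moment m b)"
  unfolding circ_moment_def[abs_def]
  by (rule integral_continuous_on_param[of S 0 "2 * pi" "\<lambda>x t. chord_sq b x t powr m * (x + b * cos t)",
        unfolded case_prod_beta cbox_interval])
    (intro continuous_intros continuous_on_chord_powr; simp)

lemma circ_integral_pos:
  fixes f :: "real \<Rightarrow> real"
  assumes "continuous_on {0..2 * pi} f" "\<And>t. 0 < f t"
  shows "0 < integral {0..2 * pi} f"
  using integral_less_real[of 0 "2 * pi" "\<lambda>_. 0" f] assms pi_gt_zero by (auto simp: not_le)

lemma circ_pow_pos:
  assumes "\<bar>x\<bar> \<noteq> \<bar>b\<bar>"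
  shows "0 < circ_pow m b x"
  unfolding circ_pow_def
proof (rule circ_integral_pos)
  show "0 < chord_sq b x t powr m" for t using chord_sq_pos[OF assms, of t] by simp
qed (use assms in \<open>intro continuous_on_chord_powr continuous_intros, auto\<close>)

text \<open>For \<open>x > b\<close> the integrand itself is positive. For \<open>x < b\<close> it
  changes sign; there \<open>x * circ_moment m b x\<close> starts from 0 at \<open>x = 0\<close> and
  has positive derivative because \<open>m > -1\<close>. Negative \<open>m\<close> is included since
  the monotonicity of h calls this with \<open>m - 1\<close>.\<close>

lemma circ_moment_pos:
  assumes "0 \<le> b" "0 < x" "x \<noteq> b" "m > -1"
  shows "0 < circ_moment m b x"
proof (cases "x < b")
  case True
  have D: "((\<lambda>x. x * circ_moment m b x) has_real_derivative (2 * m + 2) * y * circ_pow m b y) (at y)"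
    if "y \<in> {-b<..<b}" for y
    by (rule times_circ_moment_has_derivative[of "{-b<..<b}"]) (use that in auto)
  have "(\<lambda>x. x * circ_moment m b x) 0 < (\<lambda>x. x * circ_moment m b x) x"
  proof (rule DERIV_pos_imp_increasing_open[OF \<open>0 < x\<close>])
    fix y assume y: "0 < y" "y < x"
    then have "0 < (2 * m + 2) * y * circ_pow m b y"
      using assms True by (intro mult_pos_pos circ_pow_pos) auto
    moreover have "y \<in> {-b<..<b}" using y True by auto
    ultimately show "\<exists>d. ((\<lambda>x. x * circ_moment m b x) has_real_derivative d) (at y) \<and> 0 < d"
      using D[of y] by (intro exI conjI)
  next
    have "{0..x} \<subseteq> {-b<..<b}" using True assms by auto
    moreover have "continuous_on {-b<..<b} (\<lambda>x. x * circ_moment m b x)"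
      by (rule DERIV_continuous_on[OF has_field_derivative_at_within[OF D]])
    ultimately show "continuous_on {0..x} (\<lambda>x. x * circ_moment m b x)"
      by (rule continuous_on_subset[rotated])
  qed
  then show ?thesis using assms by (simp add: zero_less_mult_iff)
next
  case False
  have "0 < chord_sq b x t powr m * (x + b * cos t)" for t
  proof -
    have "b * - cos t \<le> b * 1" using assms(1) cos_ge_minus_one[of t] by (intro mult_left_mono) auto
    moreover have "0 < chord_sq b x t" using assms by (intro chord_sq_pos) auto
    ultimately show ?thesis using False assms by (intro mult_pos_pos) auto
  qed
  then show ?thesis
    unfolding circ_moment_def using assms
    by (intro circ_integral_pos continuous_on_mult continuous_on_chord_powr continuous_intros) auto
qed

text \<open>The derivative formulas above exclude \<open>x = b\<close>; continuity carries
  monotonicity across that point.\<close>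

lemma increasing_except_one_point:
  fixes f :: "real \<Rightarrow> real"
  assumes "x < y" "continuous_on {x..y} f"
    and "\<And>z. x < z \<Longrightarrow> z < y \<Longrightarrow> z \<noteq> b \<Longrightarrow> \<exists>d. (f has_real_derivative d) (at z) \<and> 0 < d"
  shows "f x < f y"
proof (cases "x < b \<and> b < y")
  case True
  have "f x < f b"
    by (rule DERIV_pos_imp_increasing_open)
      (use True assms(3) continuous_on_subset[OF assms(2)] in auto)
  also have "f b < f y"
    by (rule DERIV_pos_imp_increasing_open)
      (use True assms(3) continuous_on_subset[OF assms(2)] in auto)
  finally show ?thesis .
next
  case False
  then show ?thesis
    using assms(3) by (intro DERIV_pos_imp_increasing_open[OF assms(1) _ assms(2)]) auto
qed

text \<open>This is the strict monotonicity of h. The quotient has derivative 2 G / x^3.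
  \<open>G\<close> vanishes at 0, and in its derivative the two \<open>circ_pow\<close> terms
  cancel, leaving 2 m (m + 1) x^2 times \<open>circ_moment (m - 1) b x\<close>, which is positive by
  \<open>circ_moment_pos\<close>.\<close>

lemma circ_moment_over_increasing:
  assumes "0 \<le> b" "0 < m" "0 < x" "x < y"
  shows "circ_moment m b x / x < circ_moment m b y / y"
proof -
  define G where "G x = (m + 1) * x\<^sup>2 * circ_pow m b x - x * circ_moment m b x" for x
  have U: "\<exists>U. open U \<and> convex U \<and> z \<in> U \<and> (\<forall>w\<in>U. \<bar>w\<bar> \<noteq> \<bar>b\<bar>)" if "0 < z" "z \<noteq> b" for z
  proof (cases "z < b")
    case True
    then show ?thesis using that by (intro exI[of _ "{-b<..<b}"]) auto
  next
    case False
    then show ?thesis using that assms by (intro exI[of _ "{b<..}"]) auto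
  qed
  have M: "((\<lambda>x. x * circ_moment m b x) has_real_derivative (2 * m + 2) * z * circ_pow m b z) (at z)"
    and N: "(circ_pow m b has_real_derivative 2 * m * circ_moment (m - 1) b z) (at z)"
    if "0 < z" "z \<noteq> b" for z
    using U[OF that] times_circ_moment_has_derivative circ_pow_has_derivative by blast+
  have Gpos: "0 < G z" if "0 < z" for z
  proof -
    have "G 0 < G z"
    proof (rule increasing_except_one_point[OF that, of _ b])
      show "continuous_on {0..z} G"
        unfolding G_def using assms
        by (intro continuous_intros continuous_on_circ_pow continuous_on_circ_moment)
      fix w assume w: "0 < w" "w < z" "w \<noteq> b"
      have "(G has_real_derivative (m + 1) * w\<^sup>2 * (2 * m * circ_moment (m - 1) b w)) (at w)"
        unfolding G_def
        by (rule DERIV_cong[OF DERIV_diff[OF DERIV_mult[OF DERIV_cmult[OF DERIV_power[OF DERIV_ident]] N] M]])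
          (use w in \<open>simp_all add: algebra_simps\<close>)
      moreover have "0 < (m + 1) * w\<^sup>2 * (2 * m * circ_moment (m - 1) b w)"
        using w assms by (intro mult_pos_pos circ_moment_pos) auto
      ultimately show "\<exists>d. (G has_real_derivative d) (at w) \<and> 0 < d" by blast
    qed
    then show ?thesis by (simp add: G_def)
  qed
  \<comment> \<open>The quotient is expanded by \<open>x\<close> because the derivative known is
    that of \<open>x * circ_moment m b x\<close>.\<close>
  have "(\<lambda>x. x * circ_moment m b x / x\<^sup>2) x < (\<lambda>x. x * circ_moment m b x / x\<^sup>2) y"
  proof (rule increasing_except_one_point[OF assms(4), of _ b])
    show "continuous_on {x..y} (\<lambda>x. x * circ_moment m b x / x\<^sup>2)"
      using assms by (intro continuous_intros continuous_on_circ_moment) auto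
    fix w assume w: "x < w" "w < y" "w \<noteq> b"
    then have "0 < w" using assms by simp
    have "((\<lambda>x. x * circ_moment m b x / x\<^sup>2) has_real_derivative 2 * G w / w ^ 3) (at w)"
      by (rule DERIV_cong[OF DERIV_divide[OF M[OF \<open>0 < w\<close> w(3)] DERIV_power[OF DERIV_ident]]])
        (use \<open>0 < w\<close> in \<open>simp_all add: G_def field_simps power2_eq_square power3_eq_cube\<close>)
    moreover have "0 < 2 * G w / w ^ 3" using Gpos \<open>0 < w\<close> by simp
    ultimately show "\<exists>d. ((\<lambda>x. x * circ_moment m b x / x\<^sup>2) has_real_derivative d) (at w) \<and> 0 < d"
      by blast
  qed
  then show ?thesis using assms by (simp add: power2_eq_square)
qed

subsection \<open>Normalized iteration of order-preserving maps\<close>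

text \<open>By \<open>mono\<close>, the positions \<open>l\<close> and \<open>u\<close> of a
  smallest and a largest coordinate stay the same along the orbit, and by \<open>ratio\<close> their
  quotient \<open>V\<close> is nondecreasing. At a limit point one more step leaves \<open>V\<close>
  unchanged, which strictness in \<open>ratio\<close> permits only when the two coordinates
  coincide. \<open>cont\<close> is sequential and coordinatewise, the form in which it is applied to
  one subsequence.\<close>

lemma normalized_iteration_tendsto:
  fixes A :: "('d::finite \<Rightarrow> real) \<Rightarrow> 'd \<Rightarrow> real" and x :: "nat \<Rightarrow> 'd \<Rightarrow> real"
  assumes cont: "\<And>X y j. (\<And>i. (\<lambda>n::nat. X n i) \<longlonglongrightarrow> y i) \<Longrightarrow> (\<lambda>n. A (X n) j) \<longlonglongrightarrow> A y j"
    and pos: "\<And>r j. (\<And>i. 0 < r i) \<Longrightarrow> 0 < A r j"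
    and mono: "\<And>r i j. (\<And>i. 0 < r i) \<Longrightarrow> r i \<le> r j \<Longrightarrow> A r i \<le> A r j"
    and ratio: "\<And>r i j. (\<And>i. 0 < r i) \<Longrightarrow> r i < r j \<Longrightarrow> r i * A r j < r j * A r i"
    and x0: "\<And>i. 0 < x 0 i" "(\<Sum>i\<in>UNIV. (x 0 i)\<^sup>2) = 1"
    and step: "\<And>n i. x (Suc n) i = A (x n) i / sqrt (\<Sum>j\<in>UNIV. (A (x n) j)\<^sup>2)"
  shows "(\<lambda>n. x n i) \<longlonglongrightarrow> 1 / sqrt (real CARD('d))"
proof -
  define S where "S n = sqrt (\<Sum>j\<in>UNIV. (A (x n) j)\<^sup>2)" for n
  have xpos: "0 < x n i" for n i
  proof (induction n arbitrary: i)
    case (Suc n)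
    have "0 < (\<Sum>j\<in>UNIV. (A (x n) j)\<^sup>2)"
      using pos[OF Suc.IH] by (intro sum_pos) (auto simp: less_imp_neq[symmetric])
    then show ?case using pos[OF Suc.IH] by (simp add: step)
  qed (use x0 in auto)
  have Spos: "0 < S n" for n
    unfolding S_def using pos[OF xpos] by (intro real_sqrt_gt_zero sum_pos) (auto simp: less_imp_neq[symmetric])
  have step': "x (Suc n) i = A (x n) i / S n" for n i
    by (simp add: step S_def)
  have norm: "(\<Sum>i\<in>UNIV. (x n i)\<^sup>2) = 1" for n
  proof (cases n)
    case (Suc k)
    have "(\<Sum>i\<in>UNIV. (x n i)\<^sup>2) = (\<Sum>i\<in>UNIV. (A (x k) i)\<^sup>2) / (S k)\<^sup>2"
      by (simp add: Suc step' power_divide sum_divide_distrib)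
    also have "(S k)\<^sup>2 = (\<Sum>i\<in>UNIV. (A (x k) i)\<^sup>2)"
      by (simp add: S_def sum_nonneg)
    also have "(\<Sum>i\<in>UNIV. (A (x k) i)\<^sup>2) / \<dots> = 1"
      using Spos[of k] by (simp add: S_def)
    finally show ?thesis .
  qed (use x0 in auto)
  obtain l where l0: "\<And>i. x 0 l \<le> x 0 i"
    using ex_min_if_finite[of "range (x 0)"] by (auto simp: not_less)
  obtain u where "x 0 u = Max (range (x 0))"
    using Max_in[of "range (x 0)"] by fastforce
  then have u0: "x 0 i \<le> x 0 u" for i
    by simp
  have lu: "x n l \<le> x n i \<and> x n i \<le> x n u" for n i
  proof (induction n arbitrary: i)
    case (Suc n)
    then show ?case
      using mono[OF xpos] Spos[of n] by (simp add: step' divide_right_mono less_imp_le)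
  qed (use l0 u0 in auto)
  define V where "V n = x n l / x n u" for n
  have V_le: "V n \<le> 1" and V_pos: "0 < V n" for n
    using lu xpos by (simp_all add: V_def)
  have V_Suc: "V (Suc n) = A (x n) l / A (x n) u" for n
    using Spos[of n] by (simp add: V_def step')
  have "incseq V"
  proof (rule incseq_SucI)
    fix n
    have "x n l * A (x n) u \<le> x n u * A (x n) l"
    proof (cases "x n l < x n u")
      case True
      then show ?thesis using ratio[of "x n" l u, OF xpos] by simp
    next
      case False
      then show ?thesis
        using mono[of "x n" u l, OF xpos] xpos lu[of n u] by (simp add: antisym_conv3)
    qed
    then show "V n \<le> V (Suc n)"
      using xpos[of n u] pos[of "x n" u, OF xpos] by (simp add: V_Suc) (simp add: V_def field_simps)
  qed
  then obtain L where L: "V \<longlonglongrightarrow> L"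
    using incseq_convergent[of V 1] V_le by blast
  \<comment> \<open>The largest coordinate is at least the quadratic mean, so the denominator of
    \<open>V\<close> stays away from 0 in the limit.\<close>
  have u_ge: "1 / sqrt (real CARD('d)) \<le> x n u" for n
  proof -
    have "1 \<le> real CARD('d) * (x n u)\<^sup>2"
      using sum_bounded_above[of UNIV "\<lambda>i. (x n i)\<^sup>2" "(x n u)\<^sup>2"] lu[of n] xpos[of n] norm[of n]
      by (simp add: power_mono less_imp_le)
    then have "1 / real CARD('d) \<le> (x n u)\<^sup>2" by (simp add: field_simps)
    then have "sqrt (1 / real CARD('d)) \<le> x n u"
      using xpos[of n u] by (intro real_le_lsqrt) auto
    then show ?thesis by (simp add: real_sqrt_divide)
  qed
  have x_le: "x n i \<le> 1" for n i
  proof -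
    have "(x n i)\<^sup>2 \<le> 1"
      using member_le_sum[of i UNIV "\<lambda>i. (x n i)\<^sup>2"] norm[of n] by simp
    then show ?thesis using xpos[of n i] by (simp add: abs_square_le_1)
  qed
  \<comment> \<open>The orbit is moved into Euclidean space to extract a convergent subsequence
    there.\<close>
  have "bounded (range (\<lambda>n. \<chi> i. x n i))"
  proof (rule boundedI[of _ "real CARD('d)"])
    fix v assume "v \<in> range (\<lambda>n. \<chi> i. x n i)"
    then obtain n where v: "v = (\<chi> i. x n i)" by auto
    have "norm v \<le> (\<Sum>i\<in>UNIV. \<bar>v $ i\<bar>)" by (rule norm_le_l1_cart)
    also have "\<dots> \<le> (\<Sum>i\<in>(UNIV::'d set). 1)"
      using xpos x_le by (intro sum_mono) (simp add: v less_imp_le abs_of_pos)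
    finally show "norm v \<le> real CARD('d)" by simp
  qed
  then obtain y s where s: "strict_mono s" and y: "(\<lambda>n. (\<lambda>n. \<chi> i. x n i) (s n)) \<longlonglongrightarrow> y"
    using bounded_imp_convergent_subsequence[of "\<lambda>n. \<chi> i. x n i"] by (auto simp: o_def)
  have yi: "(\<lambda>n. x (s n) i) \<longlonglongrightarrow> y $ i" for i
    using tendsto_vec_nth[OF y, of i] by simp
  have y_u: "0 < y $ u"
  proof -
    have "1 / sqrt (real CARD('d)) \<le> y $ u"
      by (rule LIMSEQ_le_const[OF yi]) (use u_ge in auto)
    then show ?thesis by (rule less_le_trans[rotated]) simp
  qed
  have VsL: "(\<lambda>n. V (s n)) \<longlonglongrightarrow> L" and VsL': "(\<lambda>n. V (Suc (s n))) \<longlonglongrightarrow> L"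
    using LIMSEQ_subseq_LIMSEQ[OF L s] LIMSEQ_subseq_LIMSEQ[OF LIMSEQ_Suc[OF L] s] by (simp_all add: o_def)
  have "(\<lambda>n. V (s n)) \<longlonglongrightarrow> y $ l / y $ u"
    unfolding V_def by (intro tendsto_divide yi) (use y_u in auto)
  then have L1: "L = y $ l / y $ u" using VsL LIMSEQ_unique by blast
  \<comment> \<open>Monotonicity of \<open>V\<close> keeps the limit point off the boundary of the
    positive cone, where \<open>pos\<close> and \<open>ratio\<close> say nothing.\<close>
  have "V 0 \<le> L" using \<open>incseq V\<close> L by (simp add: incseq_le)
  then have y_l: "0 < y $ l"
    using V_pos[of 0] y_u L1 by (smt (verit) divide_nonpos_pos)
  have y_pos: "0 < y $ i" for i
  proof -
    have "y $ l \<le> y $ i" by (rule LIMSEQ_le[OF yi yi]) (use lu in auto)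
    then show ?thesis using y_l by simp
  qed
  have Au: "0 < A (($) y) u" using pos[of "($) y"] y_pos by simp
  have "(\<lambda>n. V (Suc (s n))) \<longlonglongrightarrow> A (($) y) l / A (($) y) u"
    unfolding V_Suc using cont[of "\<lambda>n. x (s n)" "($) y"] yi Au by (intro tendsto_divide) auto
  then have L2: "L = A (($) y) l / A (($) y) u" using VsL' LIMSEQ_unique by blast
  have yle: "y $ l \<le> y $ u" by (rule LIMSEQ_le[OF yi yi]) (use lu in auto)
  have "y $ l / y $ u = A (($) y) l / A (($) y) u" using L1 L2 by simp
  then have "y $ l * A (($) y) u = A (($) y) l * y $ u"
    using y_u Au by (subst (asm) frac_eq_eq) auto
  then have "\<not> y $ l < y $ u"
    using ratio[of "($) y" l u] y_pos by (auto simp: mult.commute)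
  with yle L1 y_u have L_1: "L = 1" by simp
  \<comment> \<open>The smallest coordinate is at most the quadratic mean, and the largest is the
    smallest divided by \<open>V\<close>. Together with \<open>u_ge\<close> this squeezes the whole
    sequence, not only the subsequence.\<close>
  have u_le: "x n u \<le> 1 / sqrt (real CARD('d)) / V n" for n
  proof -
    have "real CARD('d) * (x n l)\<^sup>2 \<le> 1"
      using sum_bounded_below[of UNIV "(x n l)\<^sup>2" "\<lambda>i. (x n i)\<^sup>2"] lu[of n] xpos[of n] norm[of n]
      by (simp add: power_mono less_imp_le)
    then have "(x n l)\<^sup>2 \<le> 1 / real CARD('d)" by (simp add: field_simps)
    then have "x n l \<le> sqrt (1 / real CARD('d))" by (rule real_le_rsqrt)
    then have "x n l \<le> 1 / sqrt (real CARD('d))" by (simp add: real_sqrt_divide)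
    moreover have "x n u = x n l / V n" using xpos[of n l] xpos[of n u] by (simp add: V_def)
    ultimately show ?thesis using divide_right_mono[of "x n l" _ "V n"] V_pos[of n]
      by (simp only: less_imp_le)
  qed
  have "(\<lambda>n. 1 / sqrt (real CARD('d)) / V n) \<longlonglongrightarrow> 1 / sqrt (real CARD('d)) / 1"
    using L L_1 by (intro tendsto_intros) auto
  then have u_lim: "(\<lambda>n. x n u) \<longlonglongrightarrow> 1 / sqrt (real CARD('d))"
    by (intro tendsto_sandwich[of "\<lambda>_. 1 / sqrt (real CARD('d))" "\<lambda>n. x n u" sequentially])
      (use u_ge u_le in auto)
  have "(\<lambda>n. V n * x n u) \<longlonglongrightarrow> 1 * (1 / sqrt (real CARD('d)))"
    using L L_1 u_lim by (intro tendsto_mult) auto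
  moreover have "V n * x n u = x n l" for n using xpos[of n u] by (simp add: V_def)
  ultimately have l_lim: "(\<lambda>n. x n l) \<longlonglongrightarrow> 1 / sqrt (real CARD('d))" by simp
  show ?thesis
    by (rule tendsto_sandwich[OF _ _ l_lim u_lim]) (use lu in auto)
qed

subsection \<open>Invariance of Haar measure\<close>

lemma emeasure_lborel_shift:
  assumes [measurable]: "B \<in> sets borel"
  shows "emeasure lborel {t. a + t \<in> B} = emeasure lborel (B :: real set)"
proof -
  have "emeasure lborel B = emeasure (distr lborel borel ((+) a)) B"
    by (simp add: lborel_distr_plus)
  also have "\<dots> = emeasure lborel {t. a + t \<in> B}"
    by (subst emeasure_distr) (auto simp: vimage_def)
  finally show ?thesis by simp
qed

text \<open>With \<open>s\<close> the last multiple of \<open>p\<close> not exceeding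
  \<open>a\<close>, the window is cut at \<open>s + p\<close>. Shifting the left piece back by
  \<open>s\<close> and the right piece by \<open>s + p\<close> tiles \<open>{0..<p}\<close>.\<close>

lemma emeasure_periodic:
  fixes B :: "real set"
  assumes [measurable]: "B \<in> sets borel" and per: "\<And>t. t + p \<in> B \<longleftrightarrow> t \<in> B" and "0 < p"
  shows "emeasure lborel ({a..<a + p} \<inter> B) = emeasure lborel ({0..<p} \<inter> B)"
proof -
  have per_int: "t + of_int k * p \<in> B \<longleftrightarrow> t \<in> B" for t and k :: int
  proof (induction k rule: int_induct[where k = 0])
    case (step1 i)
    then show ?case using per[of "t + of_int i * p"] by (simp add: algebra_simps)
  next
    case (step2 i)
    then show ?case using per[of "t + of_int (i - 1) * p"] by (simp add: algebra_simps)
  qed simp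
  define k where "k = \<lfloor>a / p\<rfloor>"
  define s where "s = of_int k * p"
  have s: "s \<le> a" "a < s + p"
    using \<open>0 < p\<close> floor_divide_lower[of p a] floor_divide_upper[of p a]
    by (simp_all add: s_def k_def algebra_simps)
  have Bs: "s + t \<in> B \<longleftrightarrow> t \<in> B" "s + p + t \<in> B \<longleftrightarrow> t \<in> B" for t
    using per_int[of t k] per_int[of t "k + 1"] by (simp_all add: s_def algebra_simps)
  have "emeasure lborel ({a..<a + p} \<inter> B)
      = emeasure lborel (({a..<s + p} \<inter> B) \<union> ({s + p..<a + p} \<inter> B))"
    using s by (intro arg_cong[where f = "emeasure lborel"]) auto
  also have "\<dots> = emeasure lborel ({a..<s + p} \<inter> B) + emeasure lborel ({s + p..<a + p} \<inter> B)"
    by (subst plus_emeasure) auto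
  also have "emeasure lborel ({a..<s + p} \<inter> B) = emeasure lborel {t. s + t \<in> {a..<s + p} \<inter> B}"
    by (subst emeasure_lborel_shift) auto
  also have "{t. s + t \<in> {a..<s + p} \<inter> B} = {a - s..<p} \<inter> B"
    by (auto simp: Bs)
  also have "emeasure lborel ({s + p..<a + p} \<inter> B) = emeasure lborel {t. s + p + t \<in> {s + p..<a + p} \<inter> B}"
    by (subst emeasure_lborel_shift) auto
  also have "{t. s + p + t \<in> {s + p..<a + p} \<inter> B} = {0..<a - s} \<inter> B"
    by (auto simp: Bs)
  also have "emeasure lborel ({a - s..<p} \<inter> B) + emeasure lborel ({0..<a - s} \<inter> B)
      = emeasure lborel (({a - s..<p} \<inter> B) \<union> ({0..<a - s} \<inter> B))"
    by (subst plus_emeasure) auto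
  also have "({a - s..<p} \<inter> B) \<union> ({0..<a - s} \<inter> B) = {0..<p} \<inter> B"
    using s by auto
  finally show ?thesis .
qed

lemma cis_measurable [measurable]: "cis \<in> borel \<rightarrow>\<^sub>M restrict_space borel (sphere 0 1)"
  by (intro measurable_restrict_space2 borel_measurable_continuous_onI continuous_intros) auto

lemma sets_circle_measure [measurable_cong]: "sets circle_measure = sets (restrict_space borel (sphere 0 1))"
  by (simp add: circle_measure_def)

text \<open>The interval is made half-open, at the cost of a null set, to be an exact period window
  for \<open>emeasure_periodic\<close>.\<close>

lemma emeasure_circle:
  assumes [measurable]: "A \<in> sets circle_measure"
  shows "emeasure circle_measure A = emeasure lborel ({0..<2 * pi} \<inter> {t. cis t \<in> A}) / emeasure lborel {0..2 * pi}"
proof -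
  have [measurable]: "{t. cis t \<in> A} \<in> sets borel"
    using measurable_sets[OF cis_measurable, of A] assms by (simp add: vimage_def sets_circle_measure)
  have "emeasure circle_measure A = emeasure (uniform_measure lborel {0..2 * pi}) {t. cis t \<in> A}"
    unfolding circle_measure_def
    by (subst emeasure_distr) (use assms in \<open>auto simp: sets_circle_measure vimage_def space_uniform_measure\<close>)
  also have "\<dots> = emeasure lborel ({0..2 * pi} \<inter> {t. cis t \<in> A}) / emeasure lborel {0..2 * pi}"
    by (subst emeasure_uniform_measure) auto
  also have "emeasure lborel ({0..2 * pi} \<inter> {t. cis t \<in> A}) = emeasure lborel ({0..<2 * pi} \<inter> {t. cis t \<in> A})"
  proof (rule emeasure_eq_AE)
    show "AE t in lborel. (t \<in> {0..2 * pi} \<inter> {t. cis t \<in> A}) = (t \<in> {0..<2 * pi} \<inter> {t. cis t \<in> A})"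
      using AE_lborel_singleton[of "2 * pi"] by eventually_elim auto
  qed auto
  finally show ?thesis .
qed

lemma circle_rotate_measurable:
  "cmod u = 1 \<Longrightarrow> (\<lambda>z. u * z) \<in> circle_measure \<rightarrow>\<^sub>M circle_measure"
  unfolding measurable_cong_sets[OF sets_circle_measure sets_circle_measure]
  by (intro measurable_restrict_space2) (auto simp: norm_mult space_restrict_space intro!: measurable_restrict_space1)

lemma circle_cnj_measurable: "cnj \<in> circle_measure \<rightarrow>\<^sub>M circle_measure"
  unfolding measurable_cong_sets[OF sets_circle_measure sets_circle_measure]
  by (intro measurable_restrict_space2)
    (auto simp: space_restrict_space intro!: measurable_restrict_space1 borel_measurable_continuous_onI continuous_intros)

text \<open>With \<open>u = cis a\<close> the rotation becomes a shift by \<open>a\<close>, and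
  periodicity trades the shifted window for the original one.\<close>

lemma distr_circle_rotate:
  assumes "cmod u = 1"
  shows "distr circle_measure circle_measure (\<lambda>z. u * z) = circle_measure"
proof (rule measure_eqI)
  fix A assume "A \<in> sets (distr circle_measure circle_measure (\<lambda>z. u * z))"
  then have A[measurable]: "A \<in> sets circle_measure" by simp
  have [measurable]: "{t. cis t \<in> A} \<in> sets borel"
    using measurable_sets[OF cis_measurable, of A] A by (simp add: vimage_def sets_circle_measure)
  obtain a where a: "u = cis a" using assms by (metis rcis_cmod_Arg rcis_def mult_1 of_real_1)
  have sub: "A \<subseteq> sphere 0 1" using sets.sets_into_space[OF A] by simp
  have "(\<lambda>z. u * z) -` A \<inter> space circle_measure \<in> sets circle_measure"
    using circle_rotate_measurable[OF assms] A by (rule measurable_sets)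
  then have "emeasure (distr circle_measure circle_measure (\<lambda>z. u * z)) A
    = emeasure lborel ({0..<2 * pi} \<inter> {t. cis (a + t) \<in> A}) / emeasure lborel {0..2 * pi}"
    by (subst emeasure_distr) (use circle_rotate_measurable[OF assms] in \<open>auto simp: emeasure_circle a cis_mult\<close>)
  also have "emeasure lborel ({0..<2 * pi} \<inter> {t. cis (a + t) \<in> A})
      = emeasure lborel {t. a + t \<in> {a..<a + 2 * pi} \<inter> {t. cis t \<in> A}}"
    by (intro arg_cong[where f = "emeasure lborel"]) auto
  also have "\<dots> = emeasure lborel ({a..<a + 2 * pi} \<inter> {t. cis t \<in> A})"
    by (subst emeasure_lborel_shift) auto
  also have "\<dots> = emeasure lborel ({0..<2 * pi} \<inter> {t. cis t \<in> A})"
    by (rule emeasure_periodic) (auto simp flip: cis_mult)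
  finally show "emeasure (distr circle_measure circle_measure (\<lambda>z. u * z)) A = emeasure circle_measure A"
    by (simp add: emeasure_circle)
qed simp

lemma distr_circle_cnj: "distr circle_measure circle_measure cnj = circle_measure"
proof (rule measure_eqI)
  fix A assume "A \<in> sets (distr circle_measure circle_measure cnj)"
  then have A[measurable]: "A \<in> sets circle_measure" by simp
  have B[measurable]: "{t. cis t \<in> A} \<in> sets borel"
    using measurable_sets[OF cis_measurable, of A] A by (simp add: vimage_def sets_circle_measure)
  have [measurable]: "{t. cis (- t) \<in> A} \<in> sets borel"
    using measurable_sets[OF borel_measurable_uminus[OF measurable_ident] B, simplified] by (simp add: vimage_def)
  have "cnj -` A \<inter> space circle_measure \<in> sets circle_measure"
    using circle_cnj_measurable A by (rule measurable_sets)
  then have "emeasure (distr circle_measure circle_measure cnj) A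
    = emeasure lborel ({0..<2 * pi} \<inter> {t. cis (- t) \<in> A}) / emeasure lborel {0..2 * pi}"
    by (subst emeasure_distr) (use circle_cnj_measurable in \<open>auto simp: emeasure_circle cis_cnj\<close>)
  also have "emeasure lborel ({0..<2 * pi} \<inter> {t. cis (- t) \<in> A}) = emeasure (distr lborel borel uminus) ({0..<2 * pi} \<inter> {t. cis (- t) \<in> A})"
    by (simp add: lborel_distr_uminus)
  also have "\<dots> = emeasure lborel ({- (2 * pi)<..0} \<inter> {t. cis t \<in> A})"
    by (subst emeasure_distr) (auto intro!: arg_cong[where f = "emeasure lborel"])
  \<comment> \<open>Reflection has exchanged the closed and the open end; changing two endpoints
    restores a half-open window.\<close>
  also have "\<dots> = emeasure lborel ({- (2 * pi)..<- (2 * pi) + 2 * pi} \<inter> {t. cis t \<in> A})"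
  proof (rule emeasure_eq_AE)
    show "AE t in lborel. (t \<in> {- (2 * pi)<..0} \<inter> {t. cis t \<in> A}) = (t \<in> {- (2 * pi)..<- (2 * pi) + 2 * pi} \<inter> {t. cis t \<in> A})"
      using AE_lborel_singleton[of "- (2 * pi)"] AE_lborel_singleton[of 0] by eventually_elim auto
  qed auto
  also have "\<dots> = emeasure lborel ({0..<2 * pi} \<inter> {t. cis t \<in> A})"
    by (rule emeasure_periodic) (auto simp flip: cis_mult)
  finally show "emeasure (distr circle_measure circle_measure cnj) A = emeasure circle_measure A"
    by (simp add: emeasure_circle)
qed simp

text \<open>The bridge from the Haar integral to the interval integrals \<open>circ_pow\<close> and
  \<open>circ_moment\<close> are made of.\<close>

lemma circle_integral_eq:
  fixes f :: "complex \<Rightarrow> real"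
  assumes "continuous_on UNIV f"
  shows "(LINT u|circle_measure. f u) = integral {0..2 * pi} (\<lambda>t. f (cis t)) / (2 * pi)"
proof -
  have [measurable]: "f \<in> borel_measurable borel" by (rule borel_measurable_continuous_onI[OF assms])
  have [measurable]: "(\<lambda>t. f (cis t)) \<in> borel_measurable borel"
    by (intro borel_measurable_continuous_onI continuous_on_compose2[OF assms] continuous_intros) auto
  have "(LINT u|circle_measure. f u) = (LINT t|uniform_measure lborel {0..2 * pi}. f (cis t))"
    unfolding circle_measure_def by (subst integral_distr) (auto intro!: measurable_restrict_space1)
  also have "uniform_measure lborel {0..2 * pi} = density lborel (\<lambda>t. ennreal (indicator {0..2 * pi} t / (2 * pi)))"
    unfolding uniform_measure_def
    by (intro density_cong AE_I2) (auto simp: indicator_def divide_ennreal[symmetric])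
  also have "(LINT t|\<dots>. f (cis t)) = (LINT t|lborel. indicator {0..2 * pi} t * f (cis t)) / (2 * pi)"
    by (subst integral_density) auto
  also have "(LINT t|lborel. indicator {0..2 * pi} t * f (cis t)) = (LINT t:{0..2 * pi}|lborel. f (cis t))"
    by (simp add: set_lebesgue_integral_def)
  also have "\<dots> = integral {0..2 * pi} (\<lambda>t. f (cis t))"
    by (intro set_borel_integral_eq_integral borel_integrable_atLeastAtMost')
      (auto intro!: continuous_on_compose2[OF assms] continuous_intros)
  finally show ?thesis .
qed

interpretation circle: prob_space circle_measure
  by (rule prob_space_circle_measure)

interpretation torus: prob_space torus_haar
  by (rule prob_space_torus_haar)

lemma circle_id_measurable [measurable]: "(\<lambda>z. z) \<in> borel_measurable circle_measure"
  unfolding measurable_cong_sets[OF sets_circle_measure refl]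
  by (intro measurable_restrict_space1) simp

lemma cnj_measurable [measurable]: "cnj \<in> borel_measurable borel"
  by (intro borel_measurable_continuous_onI continuous_intros)

lemma torus_component_measurable_circle: "(\<lambda>z. z j) \<in> torus_haar \<rightarrow>\<^sub>M circle_measure"
  unfolding torus_haar_def by measurable

lemma torus_component_measurable [measurable]: "(\<lambda>z. z j) \<in> borel_measurable torus_haar"
  using measurable_compose[OF torus_component_measurable_circle circle_id_measurable] .

lemma measurable_into_torus:
  assumes "\<And>j. (\<lambda>x. f x j) \<in> M \<rightarrow>\<^sub>M circle_measure"
  shows "f \<in> M \<rightarrow>\<^sub>M torus_haar"
  unfolding torus_haar_def
  by (rule measurable_PiM_single') (use assms measurable_space[OF assms] in auto)

text \<open>A componentwise map pulls boxes back to boxes, and their measures determine the product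
  measure.\<close>

lemma distr_torus_componentwise:
  fixes g :: "'d::finite \<Rightarrow> complex \<Rightarrow> complex"
  assumes g: "\<And>j. g j \<in> circle_measure \<rightarrow>\<^sub>M circle_measure"
    and inv: "\<And>j. distr circle_measure circle_measure (g j) = circle_measure"
  shows "distr torus_haar torus_haar (\<lambda>z j. g j (z j)) = torus_haar"
proof -
  interpret product_sigma_finite "\<lambda>_::'d. circle_measure"
    by unfold_locales
  have meas: "(\<lambda>z j. g j (z j)) \<in> torus_haar \<rightarrow>\<^sub>M torus_haar"
    by (intro measurable_into_torus measurable_compose[OF torus_component_measurable_circle g])
  have "distr torus_haar torus_haar (\<lambda>z j. g j (z j)) = (\<Pi>\<^sub>M j\<in>UNIV. circle_measure)"
  proof (rule PiM_eqI)
    fix A :: "'d \<Rightarrow> complex set"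
    assume A: "\<And>i. i \<in> UNIV \<Longrightarrow> A i \<in> sets circle_measure"
    let ?B = "\<lambda>j. g j -` A j \<inter> space circle_measure"
    have B: "?B j \<in> sets circle_measure" for j using measurable_sets[OF g A] by simp
    have "Pi\<^sub>E UNIV A \<in> sets (torus_haar :: ('d \<Rightarrow> complex) measure)"
      unfolding torus_haar_def by (intro sets_PiM_I_finite) (use A in auto)
    then have "emeasure (distr torus_haar torus_haar (\<lambda>z j. g j (z j))) (Pi\<^sub>E UNIV A)
        = emeasure torus_haar ((\<lambda>z j. g j (z j)) -` Pi\<^sub>E UNIV A \<inter> space torus_haar)"
      by (rule emeasure_distr[OF meas])
    also have "(\<lambda>z j. g j (z j)) -` Pi\<^sub>E UNIV A \<inter> space torus_haar = Pi\<^sub>E UNIV ?B"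
      by (auto simp: space_torus_haar PiE_def Pi_def)
    also have "emeasure torus_haar (Pi\<^sub>E UNIV ?B) = (\<Prod>j\<in>UNIV. emeasure circle_measure (?B j))"
      unfolding torus_haar_def by (rule emeasure_PiM) (use B in auto)
    also have "\<dots> = (\<Prod>j\<in>UNIV. emeasure circle_measure (A j))"
    proof (rule prod.cong[OF refl])
      fix j
      have "emeasure (distr circle_measure circle_measure (g j)) (A j) = emeasure circle_measure (?B j)"
        using A by (intro emeasure_distr g) auto
      then show "emeasure circle_measure (?B j) = emeasure circle_measure (A j)" by (simp add: inv)
    qed
    finally show "emeasure (distr torus_haar torus_haar (\<lambda>z j. g j (z j))) (Pi\<^sub>E UNIV A)
        = (\<Prod>j\<in>UNIV. emeasure circle_measure (A j))" .
  qed (simp_all add: torus_haar_def)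
  then show ?thesis by (simp add: torus_haar_def)
qed

lemma torus_rotate_measurable:
  "(\<And>j. cmod (u j) = 1) \<Longrightarrow> (\<lambda>z j. u j * z j) \<in> torus_haar \<rightarrow>\<^sub>M torus_haar"
  by (intro measurable_into_torus measurable_compose[OF torus_component_measurable_circle circle_rotate_measurable])

lemma torus_cnj_measurable: "(\<lambda>z j. cnj (z j)) \<in> torus_haar \<rightarrow>\<^sub>M torus_haar"
  by (intro measurable_into_torus measurable_compose[OF torus_component_measurable_circle circle_cnj_measurable])

lemma torus_permute_measurable: "(\<lambda>z j. z (s j)) \<in> torus_haar \<rightarrow>\<^sub>M torus_haar"
  by (intro measurable_into_torus torus_component_measurable_circle)

lemma distr_torus_rotate:
  assumes "\<And>j. cmod (u j) = 1"
  shows "distr torus_haar torus_haar (\<lambda>z j. u j * z j) = torus_haar"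
  by (rule distr_torus_componentwise[of "\<lambda>j z. u j * z",
        OF circle_rotate_measurable[OF assms] distr_circle_rotate[OF assms]])

lemma distr_torus_permute:
  fixes s :: "'d::finite \<Rightarrow> 'd"
  assumes "inj s"
  shows "distr torus_haar torus_haar (\<lambda>z j. z (s j)) = torus_haar"
  using distr_PiM_reindex[of UNIV "\<lambda>_. circle_measure" s UNIV] assms prob_space_circle_measure
  by (simp add: torus_haar_def restrict_UNIV)

lemma torus_integral_rotate:
  fixes f :: "('d::finite \<Rightarrow> complex) \<Rightarrow> 'b::{banach, second_countable_topology}"
  assumes "f \<in> borel_measurable torus_haar" and "\<And>j. cmod (u j) = 1"
  shows "(LINT z|torus_haar. f (\<lambda>j. u j * z j)) = (LINT z|torus_haar. f z)"
  by (rule integral_distr[OF torus_rotate_measurable[of u, OF assms(2)] assms(1),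
        unfolded distr_torus_rotate[of u, OF assms(2)], symmetric])

lemma torus_integral_cnj:
  fixes f :: "('d::finite \<Rightarrow> complex) \<Rightarrow> 'b::{banach, second_countable_topology}"
  assumes f: "f \<in> borel_measurable torus_haar"
  shows "(LINT z|torus_haar. f (\<lambda>j. cnj (z j))) = (LINT z|torus_haar. f z)"
  by (rule integral_distr[OF torus_cnj_measurable f,
        unfolded distr_torus_componentwise[of "\<lambda>_. cnj", OF circle_cnj_measurable distr_circle_cnj], symmetric])

lemma torus_integral_permute:
  fixes f :: "('d::finite \<Rightarrow> complex) \<Rightarrow> 'b::{banach, second_countable_topology}"
  assumes "f \<in> borel_measurable torus_haar" "inj (s :: 'd \<Rightarrow> 'd)"
  shows "(LINT z|torus_haar. f (\<lambda>j. z (s j))) = (LINT z|torus_haar. f z)"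
  by (rule integral_distr[OF torus_permute_measurable[of s] assms(1),
        unfolded distr_torus_permute[OF assms(2)], symmetric])

lemma torus_integrable_rotate:
  fixes f :: "('d::finite \<Rightarrow> complex) \<Rightarrow> 'b::{banach, second_countable_topology}"
  assumes "integrable torus_haar f" "\<And>j. cmod (u j) = 1"
  shows "integrable torus_haar (\<lambda>z. f (\<lambda>j. u j * z j))"
  using assms(1) distr_torus_rotate[of u, OF assms(2)]
  by (intro integrable_distr[OF torus_rotate_measurable[OF assms(2)]]) simp

lemma torus_integrable_permute:
  fixes f :: "('d::finite \<Rightarrow> complex) \<Rightarrow> 'b::{banach, second_countable_topology}"
  assumes "integrable torus_haar f" "inj (s :: 'd \<Rightarrow> 'd)"
  shows "integrable torus_haar (\<lambda>z. f (\<lambda>j. z (s j)))"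
  using assms(1) distr_torus_permute[OF assms(2)]
  by (intro integrable_distr[OF torus_permute_measurable]) simp

section \<open>Averaging over a common rotation of some coordinates\<close>

definition rotate_on :: "'d set \<Rightarrow> complex \<Rightarrow> ('d \<Rightarrow> complex) \<Rightarrow> 'd \<Rightarrow> complex" where
  "rotate_on J u z = (\<lambda>j. if j \<in> J then u * z j else z j)"

lemma rotate_on_eq: "rotate_on J u z = (\<lambda>j. (if j \<in> J then u else 1) * z j)"
  by (auto simp: rotate_on_def)

text \<open>Fubini on circle times torus: for each fixed \<open>u\<close> the rotation preserves
  Haar measure, so the inner integral does not depend on \<open>u\<close>. The bound
  \<open>B\<close> gives joint integrability.\<close>

lemma torus_integral_average:
  fixes f :: "('d::finite \<Rightarrow> complex) \<Rightarrow> 'b::{banach, second_countable_topology}"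
  assumes f: "f \<in> borel_measurable torus_haar" and B: "\<And>z. z \<in> space torus_haar \<Longrightarrow> norm (f z) \<le> B"
  shows "integrable torus_haar (\<lambda>z. LINT u|circle_measure. f (rotate_on J u z))"
    and "(LINT z|torus_haar. LINT u|circle_measure. f (rotate_on J u z)) = (LINT z|torus_haar. f z)"
proof -
  interpret P: pair_prob_space circle_measure "torus_haar :: ('d \<Rightarrow> complex) measure"
    by unfold_locales
  have snd_comp: "(\<lambda>p. snd p j) \<in> circle_measure \<Otimes>\<^sub>M torus_haar \<rightarrow>\<^sub>M circle_measure" for j :: 'd
    by (rule measurable_compose[OF measurable_snd torus_component_measurable_circle])
  have mult_comp: "(\<lambda>p. fst p * snd p j) \<in> circle_measure \<Otimes>\<^sub>M torus_haar \<rightarrow>\<^sub>M circle_measure" for j :: 'd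
    unfolding measurable_cong_sets[OF refl sets_circle_measure]
  proof (intro measurable_restrict_space2)
    show "(\<lambda>p. fst p * snd p j) \<in> borel_measurable (circle_measure \<Otimes>\<^sub>M torus_haar)"
      by (intro borel_measurable_times measurable_compose[OF measurable_fst circle_id_measurable]
          measurable_compose[OF measurable_snd torus_component_measurable])
  qed (auto simp: space_pair_measure space_torus_haar norm_mult)
  have m: "(\<lambda>p. rotate_on J (fst p) (snd p)) \<in> circle_measure \<Otimes>\<^sub>M torus_haar \<rightarrow>\<^sub>M (torus_haar :: ('d \<Rightarrow> complex) measure)"
    unfolding rotate_on_def
  proof (rule measurable_into_torus)
    fix j show "(\<lambda>p. if j \<in> J then fst p * snd p j else snd p j) \<in> circle_measure \<Otimes>\<^sub>M torus_haar \<rightarrow>\<^sub>M circle_measure"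
      by (cases "j \<in> J") (simp_all only: if_True if_False snd_comp mult_comp)
  qed
  have int: "integrable (circle_measure \<Otimes>\<^sub>M torus_haar) (\<lambda>(u, z). f (rotate_on J u z))"
  proof (rule P.integrable_const_bound[where B = B])
    show "AE p in circle_measure \<Otimes>\<^sub>M torus_haar. norm (case p of (u, z) \<Rightarrow> f (rotate_on J u z)) \<le> B"
      using measurable_space[OF m] by (intro AE_I2) (auto intro!: B simp: split_beta)
    show "(\<lambda>(u, z). f (rotate_on J u z)) \<in> borel_measurable (circle_measure \<Otimes>\<^sub>M torus_haar)"
      using measurable_compose[OF m f] unfolding case_prod_beta .
  qed
  show "integrable torus_haar (\<lambda>z. LINT u|circle_measure. f (rotate_on J u z))"
    using P.integrable_snd[OF int] .
  have "(LINT z|torus_haar. LINT u|circle_measure. f (rotate_on J u z))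
      = (LINT u|circle_measure. LINT z|torus_haar. f (rotate_on J u z))"
    by (rule P.Fubini_integral[OF int])
  also have "\<dots> = (LINT u|circle_measure. LINT z|torus_haar. f z)"
  proof (rule Bochner_Integration.integral_cong[OF refl])
    fix u assume "u \<in> space circle_measure"
    then have "cmod u = 1" by simp
    show "(LINT z|torus_haar. f (rotate_on J u z)) = (LINT z|torus_haar. f z)"
      unfolding rotate_on_eq by (rule torus_integral_rotate[OF f]) (simp add: \<open>cmod u = 1\<close>)
  qed
  also have "\<dots> = (LINT z|torus_haar. f z)"
    using circle.prob_space by simp
  finally show "(LINT z|torus_haar. LINT u|circle_measure. f (rotate_on J u z)) = (LINT z|torus_haar. f z)" .
qed

lemma circle_integral_rotate:
  fixes f :: "complex \<Rightarrow> 'b::{banach, second_countable_topology}"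
  assumes "f \<in> borel_measurable circle_measure" "cmod u = 1"
  shows "(LINT z|circle_measure. f (u * z)) = (LINT z|circle_measure. f z)"
  by (rule integral_distr[OF circle_rotate_measurable[OF assms(2)] assms(1),
        unfolded distr_circle_rotate[OF assms(2)], symmetric])

lemma circle_integral_cnj:
  fixes f :: "complex \<Rightarrow> 'b::{banach, second_countable_topology}"
  assumes "f \<in> borel_measurable circle_measure"
  shows "(LINT z|circle_measure. f (cnj z)) = (LINT z|circle_measure. f z)"
  by (rule integral_distr[OF circle_cnj_measurable assms, unfolded distr_circle_cnj, symmetric])

section \<open>The nonlinearity |x|^q x and its circular means\<close>

definition pow_dir :: "real \<Rightarrow> complex \<Rightarrow> complex" where
  "pow_dir q x = of_real (cmod x powr q) * x"

lemma pow_dir_measurable [measurable]: "pow_dir q \<in> borel_measurable borel"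
  unfolding pow_dir_def[abs_def] by measurable

lemma pow_dir_mult_unit: "cmod u = 1 \<Longrightarrow> pow_dir q (u * x) = u * pow_dir q x"
  by (simp add: pow_dir_def norm_mult)

lemma pow_dir_cnj: "pow_dir q (cnj x) = cnj (pow_dir q x)"
  by (simp add: pow_dir_def)

lemma norm_pow_dir_le: "0 \<le> q \<Longrightarrow> cmod x \<le> B \<Longrightarrow> cmod (pow_dir q x) \<le> B powr q * B"
  using norm_ge_zero[of x] by (simp add: pow_dir_def norm_mult mult_mono powr_mono2)

lemma continuous_on_pow_dir: "0 < q \<Longrightarrow> continuous_on S (pow_dir q)"
  unfolding pow_dir_def[abs_def]
  by (intro continuous_on_mult continuous_on_of_real continuous_on_powr' continuous_on_norm
      continuous_on_id continuous_on_const) auto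

text \<open>\<open>pow_dir q\<close> is the gradient of the strictly convex function |x|^(q+2) /
  (q+2). Directly: for equal moduli the difference is a positive multiple of \<open>x - y\<close>;
  otherwise Re (x cnj y) \<le> |x| |y| bounds the expression below by (|x|^(q+1) - |y|^(q+1)) (|x| -
  |y|).\<close>

lemma pow_dir_strict_mono:
  assumes "0 \<le> q" "x \<noteq> y"
  shows "0 < Re ((pow_dir q x - pow_dir q y) * cnj (x - y))"
proof -
  let ?a = "cmod x" and ?b = "cmod y"
  have sq: "Re (w * cnj w) = (cmod w)\<^sup>2" for w
    by (simp only: cmod_power2) (simp add: power2_eq_square)
  have Re_mult: "Re (of_real a * w) = a * Re w" for a w by simp
  show ?thesis
  proof (cases "?a = ?b")
    case True
    then have "?b \<noteq> 0" using assms(2) by auto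
    have "(pow_dir q x - pow_dir q y) * cnj (x - y) = of_real (?b powr q) * ((x - y) * cnj (x - y))"
      by (simp add: pow_dir_def True algebra_simps)
    then have "Re ((pow_dir q x - pow_dir q y) * cnj (x - y)) = ?b powr q * (cmod (x - y))\<^sup>2"
      by (simp only: Re_mult sq)
    then show ?thesis using \<open>?b \<noteq> 0\<close> assms(2) by simp
  next
    case False
    have "Re (x * cnj y) \<le> ?a * ?b"
      using complex_Re_le_cmod[of "x * cnj y"] by (simp add: norm_mult)
    then have "(?a powr q + ?b powr q) * Re (x * cnj y) \<le> (?a powr q + ?b powr q) * (?a * ?b)"
      by (intro mult_left_mono) auto
    moreover have "Re ((pow_dir q x - pow_dir q y) * cnj (x - y))
        = ?a powr q * ?a\<^sup>2 + ?b powr q * ?b\<^sup>2 - (?a powr q + ?b powr q) * Re (x * cnj y)"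
      unfolding sq[symmetric] by (simp add: pow_dir_def algebra_simps)
    moreover have "0 < (?a powr q * ?a - ?b powr q * ?b) * (?a - ?b)"
    proof -
      have less: "s powr q * s < t powr q * t" if "0 \<le> s" "s < t" for s t :: real
      proof -
        have "s powr q * s \<le> t powr q * s"
          using that assms(1) by (intro mult_right_mono powr_mono2) auto
        also have "\<dots> < t powr q * t" using that by simp
        finally show ?thesis .
      qed
      show ?thesis
        using less[of ?a ?b] less[of ?b ?a] False
        by (cases "?a < ?b") (auto intro: mult_neg_neg mult_pos_pos)
    qed
    ultimately show ?thesis
      by (simp add: power2_eq_square algebra_simps)
  qed
qed

text \<open>The phase \<open>e\<close> of \<open>v\<close> is factored out, and the remaining
  relative phase \<open>f\<close> of \<open>w\<close> is absorbed by rotation invariance. What is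
  left is invariant under conjugation, hence real, and its real part is \<open>circ_moment\<close>.
  The mean is thus a real multiple of \<open>v\<close>.\<close>

lemma circle_integral_pow_dir:
  assumes "0 < q" "v \<noteq> 0"
  shows "(LINT u|circle_measure. pow_dir q (v + u * w))
    = v * of_real (circ_moment (q / 2) (cmod w) (cmod v) / cmod v / (2 * pi))"
proof -
  let ?r = "cmod v" and ?b = "cmod w"
  define e where "e = sgn v"
  obtain f where f: "cmod f = 1" "w = of_real ?b * e * f"
  proof (cases "w = 0")
    case True then show ?thesis by (intro that[of 1]) auto
  next
    case False
    then show ?thesis using assms(2)
      by (intro that[of "sgn w / e"])
        (auto simp: e_def norm_divide norm_mult norm_sgn sgn_eq)
  qed
  have e: "cmod e = 1" "v = of_real ?r * e"
    using assms(2) by (auto simp: e_def norm_divide sgn_eq)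
  define g where "g u = pow_dir q (of_real ?r + of_real ?b * u)" for u
  have [measurable]: "g \<in> borel_measurable circle_measure"
    unfolding g_def[abs_def] by measurable
  have cg: "continuous_on UNIV g"
    unfolding g_def[abs_def] using assms(1)
    by (intro continuous_on_compose2[OF continuous_on_pow_dir] continuous_intros) auto
  have g_bound: "cmod (g u) \<le> (?r + ?b) powr q * (?r + ?b)" if "cmod u = 1" for u
    unfolding g_def using assms(1) that
    by (intro norm_pow_dir_le norm_triangle_le) (auto simp: norm_mult)
  have int: "integrable circle_measure g"
    by (rule circle.integrable_const_bound[OF AE_I2[OF g_bound]]) simp_all
  have "(LINT u|circle_measure. pow_dir q (v + u * w)) = (LINT u|circle_measure. e * g (f * u))"
  proof (rule Bochner_Integration.integral_cong[OF refl])
    fix u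
    have "v + u * w = e * (of_real ?r + of_real ?b * (f * u))"
      by (subst e(2), subst f(2)) (simp add: algebra_simps)
    then show "pow_dir q (v + u * w) = e * g (f * u)"
      by (simp add: g_def pow_dir_mult_unit e(1))
  qed
  also have "\<dots> = e * (LINT u|circle_measure. g u)"
    using circle_integral_rotate[of g f] f(1) by simp
  also have "(LINT u|circle_measure. g u) = of_real (circ_moment (q / 2) ?b ?r / (2 * pi))"
  proof (rule complex_eqI)
    have "g (cnj u) = cnj (g u)" for u
      by (simp add: g_def flip: pow_dir_cnj)
    then have "cnj (LINT u|circle_measure. g u) = (LINT u|circle_measure. g (cnj u))"
      by simp
    then have "cnj (LINT u|circle_measure. g u) = (LINT u|circle_measure. g u)"
      by (simp add: circle_integral_cnj)
    then show "Im (LINT u|circle_measure. g u) = Im (complex_of_real (circ_moment (q / 2) ?b ?r / (2 * pi)))"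
      by (simp add: complex_eq_iff)
    have "Re (LINT u|circle_measure. g u) = (LINT u|circle_measure. Re (g u))"
      using int by simp
    also have "\<dots> = integral {0..2 * pi} (\<lambda>t. Re (g (cis t))) / (2 * pi)"
      by (rule circle_integral_eq) (intro continuous_intros cg)
    also have "integral {0..2 * pi} (\<lambda>t. Re (g (cis t))) = circ_moment (q / 2) ?b ?r"
    proof -
      have "Re (g (cis t)) = chord_sq ?b ?r t powr (q / 2) * (?r + ?b * cos t)" for t
      proof -
        have "chord_sq ?b ?r t powr (q / 2) = cmod (of_real ?r + of_real ?b * cis t) powr q"
          unfolding chord_sq_eq_cmod
          by (cases "of_real ?r + of_real ?b * cis t = 0") (simp_all add: powr_powr flip: powr_numeral)
        then show ?thesis by (simp add: g_def pow_dir_def)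
      qed
      then show ?thesis by (simp add: circ_moment_def)
    qed
    finally show "Re (LINT u|circle_measure. g u) = Re (complex_of_real (circ_moment (q / 2) ?b ?r / (2 * pi)))"
      by simp
  qed
  finally show ?thesis
    by (subst (2) e(2)) (use assms(2) in simp)
qed

subsection \<open>Fourier coefficients of powers of linear forms\<close>

definition linear_form :: "('d::finite \<Rightarrow> complex) \<Rightarrow> ('d \<Rightarrow> complex) \<Rightarrow> complex" where
  "linear_form c z = (\<Sum>j\<in>UNIV. c j * z j)"

text \<open>These turn out to be the coefficients of the Riesz projection of
  \<open>pow_dir q (linear_form c z)\<close>, which is again a linear form.\<close>

definition pow_coeff :: "real \<Rightarrow> ('d::finite \<Rightarrow> complex) \<Rightarrow> 'd \<Rightarrow> complex" where
  "pow_coeff q c j = (LINT z|torus_haar. pow_dir q (linear_form c z) * cnj (z j))"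

lemma linear_form_measurable [measurable]: "linear_form c \<in> borel_measurable torus_haar"
  unfolding linear_form_def[abs_def] by measurable

lemma norm_linear_form_le:
  assumes "z \<in> space torus_haar"
  shows "cmod (linear_form c z) \<le> (\<Sum>j\<in>UNIV. cmod (c j))"
  unfolding linear_form_def
  by (rule order_trans[OF norm_sum]) (use assms in \<open>simp add: norm_mult space_torus_haar\<close>)

lemma integrable_pow_dir_linear_form:
  assumes "0 \<le> q" and [measurable]: "g \<in> borel_measurable torus_haar"
    and B: "\<And>z. z \<in> space torus_haar \<Longrightarrow> cmod (g z) \<le> B"
  shows "integrable torus_haar (\<lambda>z. pow_dir q (linear_form c z) * g z)"
proof (rule torus.integrable_const_bound)
  let ?S = "\<Sum>j\<in>UNIV. cmod (c j)"
  show "AE z in torus_haar. norm (pow_dir q (linear_form c z) * g z) \<le> ?S powr q * ?S * B"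
    unfolding norm_mult
    by (intro AE_I2 mult_mono norm_pow_dir_le assms norm_linear_form_le mult_nonneg_nonneg sum_nonneg) auto
qed measurable

lemma pow_coeff_integrable:
  "0 \<le> q \<Longrightarrow> integrable torus_haar (\<lambda>z. pow_dir q (linear_form c z) * cnj (z j))"
  by (rule integrable_pow_dir_linear_form[where B = 1]) (auto simp: space_torus_haar)

text \<open>A rotation of the variables absorbs the phases \<open>u\<close>. Consequently the
  arguments of the coefficients never change under the iteration and only the moduli evolve.\<close>

lemma pow_coeff_rotate:
  assumes u: "\<And>j. cmod (u j) = 1"
  shows "pow_coeff q (\<lambda>j. u j * c j) j = u j * pow_coeff q c j"
proof -
  let ?f = "\<lambda>z. pow_dir q (linear_form c z) * cnj (z j)"
  have "u j * pow_coeff q c j = u j * (LINT z|torus_haar. ?f (\<lambda>i. u i * z i))"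
    unfolding pow_coeff_def by (subst torus_integral_rotate) (auto simp: u)
  also have "\<dots> = (LINT z|torus_haar. u j * ?f (\<lambda>i. u i * z i))"
    by simp
  also have "(\<lambda>z. u j * ?f (\<lambda>i. u i * z i))
      = (\<lambda>z. pow_dir q (linear_form (\<lambda>j. u j * c j) z) * cnj (z j))"
  proof
    fix z
    have "u j * cnj (u j) = 1" using u[of j] by (simp add: complex_norm_square[symmetric])
    moreover have "linear_form c (\<lambda>i. u i * z i) = linear_form (\<lambda>j. u j * c j) z"
      by (simp add: linear_form_def mult_ac)
    ultimately show "u j * ?f (\<lambda>i. u i * z i) = pow_dir q (linear_form (\<lambda>j. u j * c j) z) * cnj (z j)"
      by (simp add: mult_ac)
  qed
  finally show ?thesis by (simp add: pow_coeff_def)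
qed

text \<open>This is the map A of the overview; by \<open>pow_coeff_of_real\<close> taking the real
  part discards nothing.\<close>

definition real_coeff :: "real \<Rightarrow> ('d::finite \<Rightarrow> real) \<Rightarrow> 'd \<Rightarrow> real" where
  "real_coeff q r j = Re (pow_coeff q (\<lambda>j. of_real (r j)) j)"

abbreviation real_form :: "('d::finite \<Rightarrow> real) \<Rightarrow> ('d \<Rightarrow> complex) \<Rightarrow> complex" where
  "real_form r \<equiv> linear_form (\<lambda>j. of_real (r j))"

text \<open>Conjugating all variables preserves Haar measure and, the coefficients being real,
  conjugates the integrand.\<close>

lemma pow_coeff_of_real: "pow_coeff q (\<lambda>j. of_real (r j)) j = of_real (real_coeff q r j)"
proof -
  let ?f = "\<lambda>z. pow_dir q (real_form r z) * cnj (z j)"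
  have "real_form r (\<lambda>i. cnj (z i)) = cnj (real_form r z)" for z
    by (simp add: linear_form_def)
  then have "?f (\<lambda>i. cnj (z i)) = cnj (?f z)" for z
    by (simp add: pow_dir_cnj)
  then have "cnj (pow_coeff q (\<lambda>j. of_real (r j)) j) = (LINT z|torus_haar. ?f (\<lambda>i. cnj (z i)))"
    by (simp only: Bochner_Integration.integral_cnj[symmetric] pow_coeff_def)
  also have "\<dots> = pow_coeff q (\<lambda>j. of_real (r j)) j"
    unfolding pow_coeff_def by (rule torus_integral_cnj) simp
  finally show ?thesis
    unfolding real_coeff_def by (simp add: complex_eq_iff)
qed

lemma real_coeff_eq:
  assumes "0 \<le> q"
  shows "real_coeff q r j = (LINT z|torus_haar. Re (pow_dir q (real_form r z) * cnj (z j)))"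
  unfolding real_coeff_def pow_coeff_def by (rule integral_Re[symmetric]) (rule pow_coeff_integrable[OF assms])

lemma integrable_Re_pow_dir_cnj:
  assumes "0 \<le> q" "\<And>z. z \<in> space torus_haar \<Longrightarrow> cmod (g z) \<le> B"
    and [measurable]: "g \<in> borel_measurable torus_haar"
  shows "integrable torus_haar (\<lambda>z. Re (pow_dir q (linear_form c z) * cnj (g z)))"
  by (intro integrable_Re integrable_pow_dir_linear_form[where B = B] assms(1)) (simp_all add: assms(2))

lemma torus_integral_rotate_on:
  fixes f :: "('d::finite \<Rightarrow> complex) \<Rightarrow> 'b::{banach, second_countable_topology}"
  assumes "f \<in> borel_measurable torus_haar" "cmod u = 1"
  shows "(LINT z|torus_haar. f (rotate_on J u z)) = (LINT z|torus_haar. f z)"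
  unfolding rotate_on_eq by (rule torus_integral_rotate) (use assms in auto)

lemma torus_integrable_rotate_on:
  fixes f :: "('d::finite \<Rightarrow> complex) \<Rightarrow> 'b::{banach, second_countable_topology}"
  assumes "integrable torus_haar f" "cmod u = 1"
  shows "integrable torus_haar (\<lambda>z. f (rotate_on J u z))"
  unfolding rotate_on_eq by (rule torus_integrable_rotate) (use assms in auto)

text \<open>The integrand at \<open>z\<close> is added to the one at \<open>?S z\<close>, where the
  sign of z_j is reversed. The two values of the form differ by 2 r_j z_j, so
  \<open>pow_dir_strict_mono\<close> makes the sum positive at every point.\<close>

lemma real_coeff_pos:
  fixes r :: "'d::finite \<Rightarrow> real"
  assumes "0 \<le> q" "0 < r j"
  shows "0 < real_coeff q r j"
proof -
  let ?F = "\<lambda>z. pow_dir q (real_form r z)"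
  let ?S = "rotate_on {j} (-1)"
  let ?f = "\<lambda>z. Re (?F z * cnj (z j))"
  have int: "integrable torus_haar ?f"
    using assms by (intro integrable_Re_pow_dir_cnj[where B = 1]) (auto simp: space_torus_haar)
  have int': "integrable torus_haar (\<lambda>z. ?f (?S z))"
    using torus_integrable_rotate_on[OF int, of "-1" "{j}"] by simp
  have diff: "real_form r z - real_form r (?S z) = of_real (2 * r j) * z j" for z
  proof -
    have "real_form r z - real_form r (?S z) = (\<Sum>i\<in>UNIV. if i = j then of_real (2 * r j) * z j else 0)"
      unfolding linear_form_def sum_subtractf[symmetric] by (rule sum.cong) (auto simp: rotate_on_def)
    then show ?thesis by simp
  qed
  have "0 < (LINT z|torus_haar. ?f z + ?f (?S z))"
  proof -
    have "(LINT z|(torus_haar :: ('d \<Rightarrow> complex) measure). 0) < (LINT z|torus_haar. ?f z + ?f (?S z))"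
    proof (rule torus.integral_less_AE_space)
      show "AE z in torus_haar. 0 < ?f z + ?f (?S z)"
      proof (rule AE_I2)
        fix z :: "'d \<Rightarrow> complex" assume "z \<in> space torus_haar"
        then have "z j \<noteq> 0" by (metis (mono_tags) space_torus_haar mem_Collect_eq norm_zero zero_neq_one)
        then have "real_form r z \<noteq> real_form r (?S z)" using diff[of z] assms(2) by auto
        from pow_dir_strict_mono[OF assms(1) this]
        have "0 < 2 * r j * Re ((?F z - ?F (?S z)) * cnj (z j))"
          unfolding diff by (simp add: algebra_simps)
        then have "0 < Re ((?F z - ?F (?S z)) * cnj (z j))" using assms(2) by (simp add: zero_less_mult_iff)
        moreover have "?f (?S z) = - Re (?F (?S z) * cnj (z j))" by (simp add: rotate_on_def)
        ultimately show "0 < ?f z + ?f (?S z)" by (simp add: left_diff_distrib)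
      qed
    qed (use int int' in \<open>simp_all add: torus.emeasure_space_1\<close>)
    then show ?thesis by simp
  qed
  also have "(LINT z|torus_haar. ?f z + ?f (?S z)) = 2 * real_coeff q r j"
    using torus_integral_rotate_on[of ?f "-1" "{j}"] int int'
    by (simp add: real_coeff_eq[OF assms(1)])
  finally show ?thesis by simp
qed


text \<open>Same pairing with the exchange of z_i and z_k in place of the sign change: the two
  values of the form now differ by (r_k - r_i) (z_k - z_i).\<close>

lemma real_coeff_mono:
  fixes r :: "'d::finite \<Rightarrow> real"
  assumes "0 \<le> q" "r i \<le> r k"
  shows "real_coeff q r i \<le> real_coeff q r k"
proof -
  let ?F = "\<lambda>z. pow_dir q (real_form r z)"
  let ?s = "Transposition.transpose i k"
  let ?S = "\<lambda>z :: 'd \<Rightarrow> complex. \<lambda>j. z (?s j)"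
  define f where "f j z = Re (?F z * cnj (z j))" for j z
  have coeff: "real_coeff q r j = (LINT z|torus_haar. f j z)" for j
    unfolding f_def by (rule real_coeff_eq[OF assms(1)])
  have int: "integrable torus_haar (f j)" for j
    unfolding f_def using assms by (intro integrable_Re_pow_dir_cnj[where B = 1]) (auto simp: space_torus_haar)
  have int': "integrable torus_haar (\<lambda>z. f j (?S z))" for j
    by (rule torus_integrable_permute[OF int]) simp
  have diff: "real_form r z - real_form r (?S z) = of_real (r k - r i) * (z k - z i)" for z
  proof -
    have "real_form r (?S z) = (\<Sum>j\<in>UNIV. of_real (r (?s j)) * z j)"
      unfolding linear_form_def by (rule sum.reindex_bij_witness[of _ ?s ?s]) auto
    then have "real_form r z - real_form r (?S z)
        = (\<Sum>j\<in>UNIV. of_real (r j - r (?s j)) * z j)"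
      by (simp add: linear_form_def sum_subtractf[symmetric] algebra_simps)
    also have "\<dots> = (\<Sum>j\<in>{i, k}. of_real (r j - r (?s j)) * z j)"
      by (rule sum.mono_neutral_right) (auto simp: Transposition.transpose_def)
    also have "\<dots> = of_real (r k - r i) * (z k - z i)"
      by (cases "i = k") (auto simp: algebra_simps)
    finally show ?thesis .
  qed
  have "0 \<le> (LINT z|torus_haar. (f k z - f i z) + (f k (?S z) - f i (?S z)))"
  proof (rule integral_nonneg_AE[OF AE_I2])
    fix z :: "'d \<Rightarrow> complex"
    have eq: "(f k z - f i z) + (f k (?S z) - f i (?S z)) = Re ((?F z - ?F (?S z)) * cnj (z k - z i))"
      by (simp add: f_def algebra_simps)
    show "0 \<le> (f k z - f i z) + (f k (?S z) - f i (?S z))"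
    proof (cases "real_form r z = real_form r (?S z)")
      case True
      then show ?thesis unfolding eq by simp
    next
      case False
      then have "0 < r k - r i" using diff[of z] assms(2) by (cases "r i = r k") auto
      moreover have "0 < (r k - r i) * Re ((?F z - ?F (?S z)) * cnj (z k - z i))"
        using pow_dir_strict_mono[OF assms(1) False] unfolding diff by (simp add: algebra_simps)
      ultimately show ?thesis unfolding eq by (simp add: zero_less_mult_iff)
    qed
  qed
  also have "\<dots> = 2 * (real_coeff q r k - real_coeff q r i)"
    using torus_integral_permute[of "f k" ?s] torus_integral_permute[of "f i" ?s] int int'
    by (simp add: coeff borel_measurable_integrable)
  finally show ?thesis by simp
qed

text \<open>Dominated convergence; a convergent coordinate sequence is bounded, and the bounds
  \<open>B\<close> provide a constant majorant.\<close>

lemma real_coeff_tendsto: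
  assumes "0 < q" "\<And>i. (\<lambda>n. X n i) \<longlonglongrightarrow> y i"
  shows "(\<lambda>n. real_coeff q (X n) j) \<longlonglongrightarrow> real_coeff q y j"
proof -
  have "\<exists>B. \<forall>n. \<bar>X n i\<bar> \<le> B" for i
    using convergent_imp_Bseq[OF convergentI[OF assms(2)[of i]]] by (auto simp: Bseq_def)
  then obtain B where B: "\<bar>X n i\<bar> \<le> B i" for n i by metis
  let ?S = "\<Sum>i\<in>UNIV. B i"
  have "(\<lambda>n. LINT z|torus_haar. pow_dir q (real_form (X n) z) * cnj (z j))
      \<longlonglongrightarrow> (LINT z|torus_haar. pow_dir q (real_form y z) * cnj (z j))"
  proof (rule integral_dominated_convergence[where w = "\<lambda>_. ?S powr q * ?S"])
    show "AE z in torus_haar. (\<lambda>n. pow_dir q (real_form (X n) z) * cnj (z j))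
        \<longlonglongrightarrow> pow_dir q (real_form y z) * cnj (z j)"
    proof (rule AE_I2)
      fix z
      have "isCont (pow_dir q) (real_form y z)"
        using continuous_on_pow_dir[OF assms(1), of UNIV] by (simp add: continuous_on_eq_continuous_at)
      moreover have "(\<lambda>n. real_form (X n) z) \<longlonglongrightarrow> real_form y z"
        unfolding linear_form_def by (intro tendsto_intros assms(2))
      ultimately have "(\<lambda>n. pow_dir q (real_form (X n) z)) \<longlonglongrightarrow> pow_dir q (real_form y z)"
        by (rule isCont_tendsto_compose)
      then show "(\<lambda>n. pow_dir q (real_form (X n) z) * cnj (z j)) \<longlonglongrightarrow> pow_dir q (real_form y z) * cnj (z j)"
        by (intro tendsto_intros)
    qed
    show "AE z in torus_haar. norm (pow_dir q (real_form (X n) z) * cnj (z j)) \<le> ?S powr q * ?S" for n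
    proof (rule AE_I2)
      fix z :: "'a \<Rightarrow> complex" assume z: "z \<in> space torus_haar"
      have "cmod (real_form (X n) z) \<le> ?S"
        using norm_linear_form_le[OF z, of "\<lambda>j. of_real (X n j)"] sum_mono[of UNIV "\<lambda>i. \<bar>X n i\<bar>" B] B
        by simp
      from norm_pow_dir_le[OF less_imp_le[OF assms(1)] this] z
      show "norm (pow_dir q (real_form (X n) z) * cnj (z j)) \<le> ?S powr q * ?S"
        by (simp add: norm_mult space_torus_haar)
    qed
  qed simp_all
  then show ?thesis
    unfolding real_coeff_def pow_coeff_def by (rule tendsto_Re)
qed

section \<open>The strict ratio inequality\<close>

lemma orthogonal_combination:
  fixes a b :: complex
  assumes "cmod a = 1" "cmod b = 1"
  shows "(cmod (of_real s * a + of_real t * b))\<^sup>2 = s\<^sup>2 + t\<^sup>2 + 2 * s * t * Re (a * cnj b)"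
    and "Re ((of_real s * a + of_real t * b) * cnj (of_real t * a - of_real s * b)) = (t\<^sup>2 - s\<^sup>2) * Re (a * cnj b)"
proof -
  have a: "(Re a)\<^sup>2 + (Im a)\<^sup>2 = 1" and b: "(Re b)\<^sup>2 + (Im b)\<^sup>2 = 1"
    using assms by (metis cmod_power2 one_power2)+
  have "(s * Re a + t * Re b)\<^sup>2 + (s * Im a + t * Im b)\<^sup>2
      = s\<^sup>2 + t\<^sup>2 + 2 * s * t * (Re a * Re b + Im a * Im b)"
    using a b by algebra
  then show "(cmod (of_real s * a + of_real t * b))\<^sup>2 = s\<^sup>2 + t\<^sup>2 + 2 * s * t * Re (a * cnj b)"
    unfolding cmod_power2 by simp
  have "(s * Re a + t * Re b) * (t * Re a - s * Re b) + (s * Im a + t * Im b) * (t * Im a - s * Im b)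
      = (t\<^sup>2 - s\<^sup>2) * (Re a * Re b + Im a * Im b)"
    using a b by algebra
  then show "Re ((of_real s * a + of_real t * b) * cnj (of_real t * a - of_real s * b)) = (t\<^sup>2 - s\<^sup>2) * Re (a * cnj b)"
    by (simp add: algebra_simps)
qed

lemma circle_integrable_pow_dir:
  assumes "0 \<le> q"
  shows "integrable circle_measure (\<lambda>u. pow_dir q (v + u * w))"
proof (rule circle.integrable_const_bound[OF AE_I2])
  fix u assume "u \<in> space circle_measure"
  then show "cmod (pow_dir q (v + u * w)) \<le> (cmod v + cmod w) powr q * (cmod v + cmod w)"
    using assms by (intro norm_pow_dir_le norm_triangle_le) (auto simp: norm_mult)
qed measurable

text \<open>Averaging over a common rotation of the coordinates other than \<open>i\<close>,
  \<open>k\<close>, and then over the sign of z_k, turns the difference of the two sides into the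
  integral of a nonnegative function that is not almost everywhere zero.\<close>

lemma real_coeff_ratio:
  fixes r :: "'d::finite \<Rightarrow> real"
  assumes "0 < q" "0 < r i" "r i < r k"
  shows "r i * real_coeff q r k < r k * real_coeff q r i"
proof -
  have ik: "i \<noteq> k" using assms by auto
  define v where "v z = of_real (r i) * z i + of_real (r k) * z k" for z :: "'d \<Rightarrow> complex"
  \<comment> \<open>Integrating the pairing with \<open>v'\<close> gives r_k A_i - r_i A_k, and
    rotating the remaining coordinates fixes both \<open>v\<close> and \<open>v'\<close>.\<close>
  define v' where "v' z = of_real (r k) * z i - of_real (r i) * z k" for z :: "'d \<Rightarrow> complex"
  define w where "w z = (\<Sum>j\<in>- {i, k}. of_real (r j) * z j)" for z :: "'d \<Rightarrow> complex"
  define c where "c z = Re (z i * cnj (z k))" for z :: "'d \<Rightarrow> complex"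
  define Q where "Q z = Re (pow_dir q (real_form r z) * cnj (v' z))" for z
  define Q' where "Q' z = (LINT u|circle_measure. Q (rotate_on (- {i, k}) u z))" for z
  define h where "h b x = circ_moment (q / 2) b x / x" for b x
  let ?S = "rotate_on {k} (-1) :: ('d \<Rightarrow> complex) \<Rightarrow> 'd \<Rightarrow> complex"
  have S: "?S z \<in> space torus_haar \<and> c (?S z) = - c z \<and> w (?S z) = w z" if "z \<in> space torus_haar" for z
    using that ik by (auto simp: rotate_on_def c_def w_def space_torus_haar)
  have v_sq: "(cmod (v z))\<^sup>2 = (r i)\<^sup>2 + (r k)\<^sup>2 + 2 * r i * r k * c z" if "z \<in> space torus_haar" for z
    unfolding v_def c_def using that by (intro orthogonal_combination) (auto simp: space_torus_haar)
  have v0: "v z \<noteq> 0" if z: "z \<in> space torus_haar" for z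
  proof
    assume "v z = 0"
    then have "of_real (r i) * z i = - (of_real (r k) * z k)" by (simp add: v_def add_eq_0_iff)
    then have "cmod (of_real (r i) * z i) = cmod (of_real (r k) * z k)" by simp
    then show False using z assms by (simp add: norm_mult space_torus_haar)
  qed
  have form: "real_form r z = v z + w z" for z
  proof -
    have "UNIV = insert i (insert k (- {i, k}))" by auto
    then have "real_form r z = (\<Sum>j\<in>insert i (insert k (- {i, k})). of_real (r j) * z j)"
      unfolding linear_form_def by metis
    also have "\<dots> = v z + w z" using ik by (simp add: v_def w_def)
    finally show ?thesis .
  qed
  \<comment> \<open>The average of \<open>pow_dir\<close> is a real multiple of \<open>v\<close>, so
    only Re (v cnj v') = (r_k^2 - r_i^2) c is left of the pairing.\<close>
  have Q'_eq: "Q' z = ((r k)\<^sup>2 - (r i)\<^sup>2) / (2 * pi) * (c z * h (cmod (w z)) (cmod (v z)))"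
    if z: "z \<in> space torus_haar" for z
  proof -
    have "real_form r (rotate_on (- {i, k}) u z) = v z + u * w z" for u
      unfolding form by (simp add: v_def w_def rotate_on_def sum_distrib_left mult_ac)
    moreover have "v' (rotate_on (- {i, k}) u z) = v' z" for u
      by (simp add: v'_def rotate_on_def)
    ultimately have "Q' z = (LINT u|circle_measure. Re (pow_dir q (v z + u * w z) * cnj (v' z)))"
      by (simp add: Q'_def Q_def)
    also have "\<dots> = Re (LINT u|circle_measure. pow_dir q (v z + u * w z) * cnj (v' z))"
      using circle_integrable_pow_dir[of q "v z" "w z"] assms(1) by (intro integral_Re) simp
    also have "\<dots> = Re ((LINT u|circle_measure. pow_dir q (v z + u * w z)) * cnj (v' z))"
      by simp
    also have "\<dots> = Re (of_real (h (cmod (w z)) (cmod (v z)) / (2 * pi)) * (v z * cnj (v' z)))"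
      unfolding circle_integral_pow_dir[OF assms(1) v0[OF z]] h_def by (simp only: mult_ac)
    also have "\<dots> = h (cmod (w z)) (cmod (v z)) / (2 * pi) * Re (v z * cnj (v' z))"
      by (simp only: Re_complex_of_real times_complex.sel Im_complex_of_real mult_zero_left diff_zero)
    also have "Re (v z * cnj (v' z)) = ((r k)\<^sup>2 - (r i)\<^sup>2) * c z"
      unfolding v_def v'_def c_def using z by (intro orthogonal_combination) (auto simp: space_torus_haar)
    finally show ?thesis by simp
  qed
  have [measurable]: "v' \<in> borel_measurable torus_haar" "c \<in> borel_measurable torus_haar"
    unfolding v'_def[abs_def] c_def[abs_def] by measurable
  have v'_bound: "cmod (v' z) \<le> r k + r i" if "z \<in> space torus_haar" for z
    unfolding v'_def using assms that
    by (intro order_trans[OF norm_triangle_ineq4]) (simp add: norm_mult space_torus_haar)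
  have Q_int: "integrable torus_haar Q"
    unfolding Q_def[abs_def] using assms v'_bound by (intro integrable_Re_pow_dir_cnj[where B = "r k + r i"]) auto
  have Q_bound: "norm (Q z) \<le> (\<Sum>j\<in>UNIV. cmod (of_real (r j))) powr q * (\<Sum>j\<in>UNIV. cmod (of_real (r j))) * (r k + r i)"
    if "z \<in> space torus_haar" for z
  proof -
    have "norm (Q z) \<le> cmod (pow_dir q (real_form r z) * cnj (v' z))"
      unfolding Q_def real_norm_def by (rule abs_Re_le_cmod)
    also have "\<dots> \<le> (\<Sum>j\<in>UNIV. cmod (of_real (r j))) powr q * (\<Sum>j\<in>UNIV. cmod (of_real (r j))) * (r k + r i)"
      unfolding norm_mult complex_mod_cnj using assms v'_bound[OF that] norm_linear_form_le[OF that, of "\<lambda>j. of_real (r j)"]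
      by (intro mult_mono norm_pow_dir_le mult_nonneg_nonneg sum_nonneg) auto
    finally show ?thesis .
  qed
  note avg = torus_integral_average[OF borel_measurable_integrable[OF Q_int] Q_bound, of "- {i, k}", folded Q'_def]
  have Q'S_int: "integrable torus_haar (\<lambda>z. Q' (?S z))"
    using torus_integrable_rotate_on[OF avg(1), of "-1" "{k}"] by simp
  \<comment> \<open>Passing to \<open>?S z\<close> reverses \<open>c\<close> and fixes
    \<open>w\<close>, so the sum is a positive constant times \<open>c\<close> times a difference of
    values of \<open>h\<close>. Since |v| increases with \<open>c\<close> and \<open>h\<close>
    increases with |v|, both factors have the same sign.\<close>
  have nonneg: "0 \<le> Q' z + Q' (?S z) \<and> (Q' z + Q' (?S z) = 0 \<longrightarrow> c z = 0)" if z: "z \<in> space torus_haar" for z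
  proof -
    define K where "K = ((r k)\<^sup>2 - (r i)\<^sup>2) / (2 * pi)"
    let ?d = "h (cmod (w z)) (cmod (v z)) - h (cmod (w z)) (cmod (v (?S z)))"
    have K: "0 < K" using assms by (simp add: K_def power2_eq_square mult_strict_mono)
    have eq: "Q' z + Q' (?S z) = K * (c z * ?d)"
      using Q'_eq[OF z, folded K_def] Q'_eq[of "?S z", folded K_def] S[OF z] by (simp add: algebra_simps)
    have h_less: "h (cmod (w z)) x < h (cmod (w z)) y" if "0 < x" "x < y" for x y
      unfolding h_def using that assms(1) by (intro circ_moment_over_increasing) auto
    have cmp: "cmod (v x) < cmod (v y)" if "c x < c y" "x \<in> space torus_haar" "y \<in> space torus_haar" for x y
      using that v_sq assms by (intro power2_less_imp_less[of "cmod (v x)"]) auto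
    consider "c z = 0" | "c z > 0" | "c z < 0" by linarith
    then have "c z = 0 \<or> 0 < c z * ?d"
    proof cases
      case 2
      then have "0 < ?d" using cmp[of "?S z" z] h_less[of "cmod (v (?S z))" "cmod (v z)"] S[OF z] v0 z by simp
      then show ?thesis using 2 by simp
    next
      case 3
      then have "?d < 0" using cmp[of z "?S z"] h_less[of "cmod (v z)" "cmod (v (?S z))"] S[OF z] v0 z by simp
      then show ?thesis using 3 by (simp add: mult_neg_neg)
    qed simp
    then show ?thesis unfolding eq using K by (auto simp: less_imp_le)
  qed
  have EQ: "(LINT z|torus_haar. Q' z + Q' (?S z)) = 2 * (r k * real_coeff q r i - r i * real_coeff q r k)"
  proof -
    let ?f = "\<lambda>j z. Re (pow_dir q (real_form r z) * cnj (z j))"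
    have int: "integrable torus_haar (?f j)" for j
      using assms by (intro integrable_Re_pow_dir_cnj[where B = 1]) (auto simp: space_torus_haar)
    have "Q z = r k * ?f i z - r i * ?f k z" for z
      by (simp add: Q_def v'_def algebra_simps)
    then have "(LINT z|torus_haar. Q z) = r k * real_coeff q r i - r i * real_coeff q r k"
      using int assms by (simp add: real_coeff_eq)
    moreover have "(LINT z|torus_haar. Q' (?S z)) = (LINT z|torus_haar. Q' z)"
      using avg(1) by (intro torus_integral_rotate_on) auto
    ultimately show ?thesis using avg Q'S_int by simp
  qed
  have "0 \<le> (LINT z|torus_haar. Q' z + Q' (?S z))"
    using nonneg by (intro integral_nonneg_AE AE_I2) auto
  \<comment> \<open>A zero integral would force \<open>c\<close> to vanish almost everywhere. But
    multiplying z_i by the imaginary unit turns \<open>c\<close> into - Im (z_i cnj z_k), so the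
    squares add up to 1 and \<open>c\<close> squared integrates to 1/2.\<close>
  moreover have "(LINT z|torus_haar. Q' z + Q' (?S z)) \<noteq> 0"
  proof
    assume "(LINT z|torus_haar. Q' z + Q' (?S z)) = 0"
    then have "AE z in torus_haar. Q' z + Q' (?S z) = 0"
      using integral_nonneg_eq_0_iff_AE[of torus_haar "\<lambda>z. Q' z + Q' (?S z)"] avg(1) Q'S_int nonneg by auto
    then have c0: "AE z in torus_haar. c z = 0"
      using AE_space by eventually_elim (use nonneg in blast)
    let ?T = "rotate_on {i} \<i>"
    have c_le: "norm ((c z)\<^sup>2) \<le> 1" if "z \<in> space torus_haar" for z
      using abs_Re_le_cmod[of "z i * cnj (z k)"] that
      by (simp add: c_def norm_mult space_torus_haar abs_square_le_1)
    have c_int: "integrable torus_haar (\<lambda>z. (c z)\<^sup>2)"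
      by (rule torus.integrable_const_bound[OF AE_I2[OF c_le]]) simp_all
    have "(LINT z|torus_haar. (c z)\<^sup>2 + (c (?T z))\<^sup>2) = (LINT z|(torus_haar :: ('d \<Rightarrow> complex) measure). 1)"
    proof (rule Bochner_Integration.integral_cong[OF refl])
      fix z :: "'d \<Rightarrow> complex" assume z: "z \<in> space torus_haar"
      have "c (?T z) = - Im (z i * cnj (z k))" using ik by (simp add: c_def rotate_on_def)
      then have "(c z)\<^sup>2 + (c (?T z))\<^sup>2 = (cmod (z i * cnj (z k)))\<^sup>2"
        unfolding cmod_power2 by (simp add: c_def power2_commute)
      then show "(c z)\<^sup>2 + (c (?T z))\<^sup>2 = 1" using z by (simp add: norm_mult space_torus_haar)
    qed
    moreover have "(LINT z|torus_haar. (c z)\<^sup>2 + (c (?T z))\<^sup>2) = 2 * (LINT z|torus_haar. (c z)\<^sup>2)"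
      using torus_integral_rotate_on[of "\<lambda>z. (c z)\<^sup>2" "\<i>" "{i}"] torus_integrable_rotate_on[OF c_int, of "\<i>" "{i}"] c_int
      by simp
    moreover have "(LINT z|torus_haar. (c z)\<^sup>2) = 0"
      using integral_cong_AE[of "\<lambda>z. (c z)\<^sup>2" torus_haar "\<lambda>_. 0"] c0 by simp
    ultimately show False by (simp add: torus.prob_space)
  qed
  ultimately show ?thesis unfolding EQ by simp
qed

subsection \<open>The Riesz projection of powers of linear forms\<close>

lemma monomial_measurable [measurable]: "monomial \<alpha> \<in> borel_measurable torus_haar"
proof -
  have "(\<lambda>z. z j powi \<alpha> j) \<in> borel_measurable torus_haar" for j
    by (cases "\<alpha> j") (simp_all add: power_int_def)
  then show ?thesis
    unfolding monomial_def[abs_def] by (intro borel_measurable_prod) auto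
qed

lemma norm_monomial: "z \<in> space torus_haar \<Longrightarrow> cmod (monomial \<alpha> z) = 1"
  by (simp add: monomial_def prod_norm[symmetric] norm_power_int space_torus_haar)

lemma monomial_rotate: "monomial \<alpha> (\<lambda>j. u j * z j) = monomial \<alpha> u * monomial \<alpha> z"
  by (simp add: monomial_def power_int_mult_distrib prod.distrib)

text \<open>Rotating a coordinate \<open>k\<close> where the exponents differ by \<open>m\<close>
  through the angle \<open>pi / m\<close> multiplies the integrand by -1, so the integral equals its
  own negative.\<close>

lemma monomial_orthogonal:
  assumes "\<alpha> \<noteq> \<beta>"
  shows "(LINT z|torus_haar. monomial \<alpha> z * cnj (monomial \<beta> z)) = 0"
proof -
  obtain k where k: "\<alpha> k \<noteq> \<beta> k" using assms by auto
  define m where "m = \<alpha> k - \<beta> k"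
  define u where "u = (\<lambda>j. if j = k then cis (pi / of_int m) else 1)"
  have u: "cmod (u j) = 1" for j by (simp add: u_def)
  have mono_u: "monomial \<gamma> u = cis (pi / of_int m) powi \<gamma> k" for \<gamma>
  proof -
    have "monomial \<gamma> u = (\<Prod>j\<in>UNIV. if j = k then cis (pi / of_int m) powi \<gamma> k else 1)"
      unfolding monomial_def u_def by (rule prod.cong) auto
    then show ?thesis by simp
  qed
  have unit: "cnj (cis x powi n) = cis x powi (- n)" for x n
    by (simp add: cis_power_int cis_cnj)
  have "monomial \<alpha> u * cnj (monomial \<beta> u) = cis (pi / of_int m) powi m"
    unfolding mono_u unit m_def by (simp add: power_int_diff power_int_minus field_simps)
  also have "\<dots> = -1" using k by (simp add: cis_power_int m_def)
  finally have mu: "monomial \<alpha> u * cnj (monomial \<beta> u) = -1" .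
  let ?I = "LINT z|torus_haar. monomial \<alpha> z * cnj (monomial \<beta> z)"
  have "?I = (LINT z|torus_haar. monomial \<alpha> (\<lambda>j. u j * z j) * cnj (monomial \<beta> (\<lambda>j. u j * z j)))"
    by (rule torus_integral_rotate[symmetric]) (simp_all add: u)
  also have "\<dots> = (LINT z|torus_haar. (monomial \<alpha> u * cnj (monomial \<beta> u)) * (monomial \<alpha> z * cnj (monomial \<beta> z)))"
    by (intro Bochner_Integration.integral_cong refl) (simp add: monomial_rotate mult_ac)
  also have "\<dots> = - ?I" unfolding mu by simp
  finally show ?thesis by simp
qed

definition unit_index :: "'d \<Rightarrow> 'd \<Rightarrow> int" where
  "unit_index j = (\<lambda>i. if i = j then 1 else 0)"

lemma monomial_unit_index: "monomial (unit_index j) z = z j"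
proof -
  have "monomial (unit_index j) z = (\<Prod>i\<in>UNIV. if i = j then z j else 1)"
    unfolding monomial_def unit_index_def by (rule prod.cong) auto
  then show ?thesis by simp
qed

lemma coordinate_orthonormal:
  "(LINT z|torus_haar. z i * cnj (z j)) = (if i = j then 1 else 0)"
proof (cases "i = j")
  case True
  have "(LINT z|torus_haar. z i * cnj (z j)) = (LINT z|(torus_haar :: ('a \<Rightarrow> complex) measure). 1)"
    by (intro Bochner_Integration.integral_cong)
      (auto simp: True complex_norm_square[symmetric] space_torus_haar)
  then show ?thesis using True by (simp add: torus.prob_space)
next
  case False
  then have "unit_index i \<noteq> unit_index j" by (auto simp: unit_index_def fun_eq_iff)
  from monomial_orthogonal[OF this] False show ?thesis by (simp add: monomial_unit_index)
qed

lemma bounded_imp_L2: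
  assumes [measurable]: "f \<in> borel_measurable torus_haar" and "AE z in torus_haar. cmod (f z) \<le> B"
  shows "f \<in> L2"
proof -
  have "integrable torus_haar (\<lambda>z. (cmod (f z))\<^sup>2)"
    by (rule torus.integrable_const_bound[where B = "B\<^sup>2"])
      (use assms(2) in \<open>eventually_elim, simp add: power_mono\<close>, simp)
  then show ?thesis by (simp add: L2_def)
qed

lemma integrable_L2_mult:
  assumes "f \<in> L2" "g \<in> L2"
  shows "integrable torus_haar (\<lambda>z. f z * cnj (g z))"
proof (rule Bochner_Integration.integrable_bound)
  show "integrable torus_haar (\<lambda>z. (cmod (f z))\<^sup>2 + (cmod (g z))\<^sup>2)"
    using assms by (simp add: L2_def)
  have [measurable]: "f \<in> borel_measurable torus_haar" "g \<in> borel_measurable torus_haar"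
    using assms by (simp_all add: L2_def)
  show "(\<lambda>z. f z * cnj (g z)) \<in> borel_measurable torus_haar" by measurable
  have "x * y \<le> x\<^sup>2 + y\<^sup>2" for x y :: real
    using sum_squares_bound[of x y] zero_le_power2[of x] zero_le_power2[of y] by (cases "0 \<le> x * y") linarith+
  then show "AE z in torus_haar. norm (f z * cnj (g z)) \<le> norm ((cmod (f z))\<^sup>2 + (cmod (g z))\<^sup>2)"
    by (simp add: norm_mult)
qed

lemma L2_diff:
  assumes "f \<in> L2" "g \<in> L2"
  shows "(\<lambda>z. f z - g z) \<in> L2"
proof -
  have [measurable]: "f \<in> borel_measurable torus_haar" "g \<in> borel_measurable torus_haar"
    using assms by (simp_all add: L2_def)
  have "integrable torus_haar (\<lambda>z. (cmod (f z - g z))\<^sup>2)"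
  proof (rule Bochner_Integration.integrable_bound)
    show "integrable torus_haar (\<lambda>z. 2 * (cmod (f z))\<^sup>2 + 2 * (cmod (g z))\<^sup>2)"
      using assms by (simp add: L2_def)
    show "AE z in torus_haar. norm ((cmod (f z - g z))\<^sup>2) \<le> norm (2 * (cmod (f z))\<^sup>2 + 2 * (cmod (g z))\<^sup>2)"
    proof (rule AE_I2)
      fix z
      have "(cmod (f z - g z))\<^sup>2 \<le> (cmod (f z) + cmod (g z))\<^sup>2"
        by (intro power_mono norm_triangle_ineq4) auto
      also have "\<dots> \<le> 2 * (cmod (f z))\<^sup>2 + 2 * (cmod (g z))\<^sup>2"
        using sum_squares_bound[of "cmod (f z)" "cmod (g z)"] by (simp add: power2_sum)
      finally show "norm ((cmod (f z - g z))\<^sup>2) \<le> norm (2 * (cmod (f z))\<^sup>2 + 2 * (cmod (g z))\<^sup>2)" by simp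
    qed
  qed measurable
  then show ?thesis by (simp add: L2_def)
qed

lemma monomial_L2: "monomial \<alpha> \<in> L2"
  by (rule bounded_imp_L2[where B = 1]) (simp_all add: norm_monomial AE_I2)

lemma H2_diff:
  assumes "f \<in> H2" "g \<in> H2"
  shows "(\<lambda>z. f z - g z) \<in> H2"
  using assms
  by (auto simp: H2_def fourier_coeff_def L2_diff left_diff_distrib integrable_L2_mult monomial_L2)

lemma linear_form_L2: "linear_form c \<in> L2"
  by (rule bounded_imp_L2) (auto intro!: AE_I2 norm_linear_form_le)

lemma coordinate_L2: "(\<lambda>z. z j) \<in> L2"
  using monomial_L2[of "unit_index j"] by (simp add: monomial_unit_index[abs_def])

lemma linear_form_H2: "linear_form c \<in> H2"
proof -
  have "fourier_coeff (linear_form c) \<alpha> = 0" if "\<not> (\<forall>j. 0 \<le> \<alpha> j)" for \<alpha>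
  proof -
    have "unit_index j \<noteq> \<alpha>" for j using that by (auto simp: unit_index_def split: if_splits)
    from monomial_orthogonal[OF this]
    have "(LINT z|torus_haar. z j * cnj (monomial \<alpha> z)) = 0" for j
      by (simp add: monomial_unit_index)
    moreover have "integrable torus_haar (\<lambda>z. c j * (z j * cnj (monomial \<alpha> z)))" for j
      by (simp add: integrable_L2_mult coordinate_L2 monomial_L2)
    moreover have "linear_form c z * cnj (monomial \<alpha> z) = (\<Sum>j\<in>UNIV. c j * (z j * cnj (monomial \<alpha> z)))" for z
      by (simp add: linear_form_def sum_distrib_right mult.assoc)
    ultimately show ?thesis
      by (simp add: fourier_coeff_def)
  qed
  then show ?thesis using linear_form_L2 by (auto simp: H2_def)
qed

lemma L2_norm_linear_form: "L2_norm (linear_form c) = sqrt (\<Sum>j\<in>UNIV. (cmod (c j))\<^sup>2)"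
proof -
  have int: "integrable torus_haar (\<lambda>z. c j * cnj (c i) * (z j * cnj (z i)))" for i j
    by (simp add: integrable_L2_mult coordinate_L2)
  have "complex_of_real (LINT z|torus_haar. (cmod (linear_form c z))\<^sup>2)
      = (LINT z|torus_haar. of_real ((cmod (linear_form c z))\<^sup>2))"
    by (rule integral_complex_of_real[symmetric])
  also have "\<dots> = (LINT z|torus_haar. (\<Sum>j\<in>UNIV. \<Sum>i\<in>UNIV. c j * cnj (c i) * (z j * cnj (z i))))"
    by (intro Bochner_Integration.integral_cong refl, simp only: complex_norm_square)
      (simp add: linear_form_def sum_product mult_ac)
  also have "\<dots> = (\<Sum>j\<in>UNIV. \<Sum>i\<in>UNIV. c j * cnj (c i) * (if j = i then 1 else 0))"
    using int by (simp add: coordinate_orthonormal)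
  also have "\<dots> = of_real (\<Sum>j\<in>UNIV. (cmod (c j))\<^sup>2)"
    by (simp add: complex_norm_square if_distrib cong: if_cong del: of_real_power)
  finally have "(LINT z|torus_haar. (cmod (linear_form c z))\<^sup>2) = (\<Sum>j\<in>UNIV. (cmod (c j))\<^sup>2)"
    by (simp only: of_real_eq_iff)
  then show ?thesis by (simp add: L2_norm_def)
qed

section \<open>Homogeneous trigonometric polynomials and their pairing with
  \<open>H2\<close>\<close>

inductive trig_homogeneous :: "int \<Rightarrow> (('d::finite \<Rightarrow> complex) \<Rightarrow> complex) \<Rightarrow> bool" where
  zero: "trig_homogeneous k (\<lambda>_. 0)"
| monomial: "(\<Sum>j\<in>UNIV. \<alpha> j) = k \<Longrightarrow> trig_homogeneous k (monomial \<alpha>)"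
| add: "trig_homogeneous k f \<Longrightarrow> trig_homogeneous k g \<Longrightarrow> trig_homogeneous k (\<lambda>z. f z + g z)"
| scale: "trig_homogeneous k f \<Longrightarrow> trig_homogeneous k (\<lambda>z. a * f z)"

text \<open>Agreement is required on the torus only, since conjugation equals inversion there and
  exponents of either sign add up where the coordinates are nonzero.\<close>

definition torus_homogeneous :: "int \<Rightarrow> (('d::finite \<Rightarrow> complex) \<Rightarrow> complex) \<Rightarrow> bool" where
  "torus_homogeneous k f \<longleftrightarrow> (\<exists>g. trig_homogeneous k g \<and> (\<forall>z\<in>space torus_haar. f z = g z))"

lemma trig_homogeneous_mult_power:
  fixes f :: "('d::finite \<Rightarrow> complex) \<Rightarrow> complex"
  assumes "trig_homogeneous k f"
  shows "torus_homogeneous (k + m) (\<lambda>z. z i powi m * f z)"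
  using assms
proof (induction rule: trig_homogeneous.induct)
  case (zero k)
  then show ?case unfolding torus_homogeneous_def using trig_homogeneous.zero by auto
next
  case (monomial \<alpha> k)
  let ?\<beta> = "\<lambda>j. \<alpha> j + m * unit_index i j"
  have "(\<Sum>j\<in>UNIV. ?\<beta> j) = k + m"
    using monomial by (simp add: sum.distrib unit_index_def sum_distrib_left[symmetric])
  moreover have "z i powi m * monomial \<alpha> z = monomial ?\<beta> z" if "z \<in> space torus_haar" for z
  proof -
    have nz: "z j \<noteq> 0" for j using that by (metis (mono_tags) space_torus_haar mem_Collect_eq norm_zero zero_neq_one)
    have "monomial ?\<beta> z = (\<Prod>j\<in>UNIV. (z j powi \<alpha> j) * (if j = i then z i powi m else 1))"
      unfolding monomial_def by (rule prod.cong) (auto simp: unit_index_def power_int_add nz)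
    then show ?thesis by (simp add: prod.distrib monomial_def)
  qed
  ultimately show ?case unfolding torus_homogeneous_def using trig_homogeneous.monomial by blast
next
  case (add k f g)
  then obtain f' g' where "trig_homogeneous (k + m) f'" "\<forall>z\<in>space torus_haar. z i powi m * f z = f' z"
    "trig_homogeneous (k + m) g'" "\<forall>z\<in>space torus_haar. z i powi m * g z = g' z"
    unfolding torus_homogeneous_def by auto
  then show ?case unfolding torus_homogeneous_def
    by (intro exI[of _ "\<lambda>z. f' z + g' z"]) (auto intro: trig_homogeneous.add simp: distrib_left)
next
  case (scale k f a)
  then obtain f' where "trig_homogeneous (k + m) f'" "\<forall>z\<in>space torus_haar. z i powi m * f z = f' z"
    unfolding torus_homogeneous_def by auto
  then show ?case unfolding torus_homogeneous_def
    by (intro exI[of _ "\<lambda>z. a * f' z"]) (auto intro: trig_homogeneous.scale simp: mult.left_commute)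
qed

lemma torus_homogeneous_mult_power:
  "torus_homogeneous k f \<Longrightarrow> torus_homogeneous (k + m) (\<lambda>z. z i powi m * f z)"
  using trig_homogeneous_mult_power unfolding torus_homogeneous_def by fastforce

lemma torus_homogeneous_cong:
  assumes "torus_homogeneous k g" "\<And>z. z \<in> space torus_haar \<Longrightarrow> f z = g z"
  shows "torus_homogeneous k f"
  using assms unfolding torus_homogeneous_def by (auto intro!: exI)

lemma torus_homogeneous_scale: "torus_homogeneous k f \<Longrightarrow> torus_homogeneous k (\<lambda>z. a * f z)"
  unfolding torus_homogeneous_def using trig_homogeneous.scale by fastforce

lemma torus_homogeneous_sum:
  assumes "finite A" "\<And>i. i \<in> A \<Longrightarrow> torus_homogeneous k (f i)"
  shows "torus_homogeneous k (\<lambda>z. \<Sum>i\<in>A. f i z)"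
  using assms
proof (induction A)
  case empty
  then show ?case unfolding torus_homogeneous_def using trig_homogeneous.zero by auto
next
  case (insert i A)
  then obtain g h where "trig_homogeneous k g" "\<forall>z\<in>space torus_haar. f i z = g z"
    "trig_homogeneous k h" "\<forall>z\<in>space torus_haar. (\<Sum>i\<in>A. f i z) = h z"
    unfolding torus_homogeneous_def by (metis insertCI)
  then show ?case unfolding torus_homogeneous_def using insert
    by (intro exI[of _ "\<lambda>z. g z + h z"]) (auto intro: trig_homogeneous.add)
qed

text \<open>Each factor |phi|^2 is the form times its conjugate. On the torus cnj z_i = z_i^(-1), so
  the form raises the degree by one and its conjugate lowers it by one.\<close>

lemma torus_homogeneous_norm_power:
  "torus_homogeneous 1 (\<lambda>z. of_real ((cmod (linear_form c z))\<^sup>2) ^ n * linear_form c z)"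
proof (induction n)
  case 0
  have "torus_homogeneous 1 (\<lambda>z. \<Sum>j\<in>UNIV. c j * z j)"
  proof (intro torus_homogeneous_sum torus_homogeneous_scale)
    fix j show "torus_homogeneous 1 (\<lambda>z. z j)"
      unfolding torus_homogeneous_def
      by (intro exI[of _ "monomial (unit_index j)"] conjI trig_homogeneous.monomial)
        (simp_all add: monomial_unit_index, simp add: unit_index_def)
  qed simp
  then show ?case by (simp add: linear_form_def)
next
  case (Suc n)
  let ?f = "\<lambda>z. of_real ((cmod (linear_form c z))\<^sup>2) ^ n * linear_form c z"
  have "torus_homogeneous (1 + 1 + (- 1)) (\<lambda>z. \<Sum>i\<in>UNIV. cnj (c i) * (z i powi (- 1) * (\<Sum>j\<in>UNIV. c j * (z j powi 1 * ?f z))))"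
    by (intro torus_homogeneous_sum torus_homogeneous_scale torus_homogeneous_mult_power Suc finite)
  then have "torus_homogeneous 1 (\<lambda>z. \<Sum>i\<in>UNIV. cnj (c i) * (z i powi (- 1) * (\<Sum>j\<in>UNIV. c j * (z j powi 1 * ?f z))))"
    by simp
  moreover have "of_real ((cmod (linear_form c z))\<^sup>2) ^ Suc n * linear_form c z
      = (\<Sum>i\<in>UNIV. cnj (c i) * (z i powi (- 1) * (\<Sum>j\<in>UNIV. c j * (z j powi 1 * ?f z))))"
    if "z \<in> space torus_haar" for z
  proof -
    have inv: "z i powi (- 1) = cnj (z i)" for i
    proof -
      have "z i * cnj (z i) = 1" using that by (simp add: complex_norm_square[symmetric] space_torus_haar)
      then show ?thesis by (simp add: power_int_minus inverse_unique)
    qed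
    have "(\<Sum>i\<in>UNIV. cnj (c i) * (z i powi (- 1) * (\<Sum>j\<in>UNIV. c j * (z j powi 1 * ?f z))))
        = cnj (linear_form c z) * (linear_form c z * ?f z)"
      unfolding inv by (simp add: linear_form_def sum_distrib_right mult.assoc)
    then show ?thesis by (simp add: complex_norm_square mult_ac del: of_real_power)
  qed
  ultimately show ?case by (rule torus_homogeneous_cong)
qed

text \<open>
  Pairing of \<open>f\<close> with \<open>h\<close> minus that of the orthogonal projection of \<open>f\<close> onto the linear forms;
  it vanishes for all \<open>h \<in> H2\<close> iff that projection is the Riesz projection of \<open>f\<close>.
\<close>

definition pairing_defect :: "(('d::finite \<Rightarrow> complex) \<Rightarrow> complex) \<Rightarrow> (('d \<Rightarrow> complex) \<Rightarrow> complex) \<Rightarrow> complex" where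
  "pairing_defect h f = (LINT z|torus_haar. f z * cnj (h z))
     - (\<Sum>j\<in>UNIV. (LINT z|torus_haar. f z * cnj (z j)) * (LINT z|torus_haar. z j * cnj (h z)))"

lemma pairing_defect_add:
  assumes "f \<in> L2" "g \<in> L2" "h \<in> L2"
  shows "pairing_defect h (\<lambda>z. f z + g z) = pairing_defect h f + pairing_defect h g"
  using assms
  by (simp add: pairing_defect_def coordinate_L2 integrable_L2_mult sum.distrib distrib_right)

lemma pairing_defect_diff:
  assumes "f \<in> L2" "g \<in> L2" "h \<in> L2"
  shows "pairing_defect h (\<lambda>z. f z - g z) = pairing_defect h f - pairing_defect h g"
  using assms
  by (simp add: pairing_defect_def coordinate_L2 integrable_L2_mult sum_subtractf left_diff_distrib)

lemma pairing_defect_scale: "pairing_defect h (\<lambda>z. a * f z) = a * pairing_defect h f"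
  by (simp add: pairing_defect_def mult.assoc right_diff_distrib sum_distrib_left)

text \<open>With nonnegative exponents of sum 1 the monomial is a coordinate, hence its own
  projection onto the linear forms. With a negative exponent it is orthogonal to all coordinates and
  to all of \<open>H2\<close>, so every term vanishes.\<close>

lemma pairing_defect_monomial:
  fixes h :: "('d::finite \<Rightarrow> complex) \<Rightarrow> complex"
  assumes h: "h \<in> H2" and \<alpha>: "(\<Sum>j\<in>UNIV. \<alpha> j) = 1"
  shows "pairing_defect h (monomial \<alpha>) = 0"
proof (cases "\<forall>j. 0 \<le> \<alpha> j")
  case True
  have "\<exists>j. \<alpha> j \<noteq> 0" using \<alpha> by (metis sum.neutral zero_neq_one)
  then obtain j where j: "1 \<le> \<alpha> j" using True by (metis int_one_le_iff_zero_less order_le_less)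
  have s: "(\<Sum>i\<in>UNIV. \<alpha> i) = \<alpha> j + (\<Sum>i\<in>- {j}. \<alpha> i)"
    by (simp add: sum.remove[of UNIV j] Compl_eq_Diff_UNIV)
  moreover have "0 \<le> (\<Sum>i\<in>- {j}. \<alpha> i)" using True by (intro sum_nonneg) auto
  ultimately have "\<alpha> j = 1" "(\<Sum>i\<in>- {j}. \<alpha> i) = 0" using \<alpha> j by linarith+
  then have "\<alpha> j = 1" "\<forall>i\<in>- {j}. \<alpha> i = 0" using True by (simp_all add: sum_nonneg_eq_0_iff)
  then have "\<alpha> = unit_index j" by (auto simp: unit_index_def)
  then show ?thesis
    by (simp add: pairing_defect_def monomial_unit_index coordinate_orthonormal if_distrib[of "\<lambda>x. x * _"] cong: if_cong)
next
  case False
  then have "\<alpha> \<noteq> unit_index j" for j by (auto simp: unit_index_def split: if_splits)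
  from monomial_orthogonal[OF this]
  have "(LINT z|torus_haar. monomial \<alpha> z * cnj (z j)) = 0" for j by (simp add: monomial_unit_index)
  moreover have "(LINT z|torus_haar. monomial \<alpha> z * cnj (h z)) = cnj (fourier_coeff h \<alpha>)"
    unfolding fourier_coeff_def Bochner_Integration.integral_cnj[symmetric] by (simp add: mult.commute)
  ultimately show ?thesis using h False by (simp add: pairing_defect_def H2_def)
qed

lemma trig_homogeneous_bounded:
  assumes "trig_homogeneous k f"
  shows "f \<in> borel_measurable torus_haar \<and> (\<exists>B. \<forall>z\<in>space torus_haar. cmod (f z) \<le> B)"
  using assms
proof (induction rule: trig_homogeneous.induct)
  case (add k f g)
  then obtain B C where "\<forall>z\<in>space torus_haar. cmod (f z) \<le> B" "\<forall>z\<in>space torus_haar. cmod (g z) \<le> C" by auto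
  then have "\<forall>z\<in>space torus_haar. cmod (f z + g z) \<le> B + C"
    by (auto intro!: norm_triangle_le add_mono)
  with add show ?case by auto
next
  case (scale k f a)
  then obtain B where "\<forall>z\<in>space torus_haar. cmod (f z) \<le> B" by auto
  then have "\<forall>z\<in>space torus_haar. cmod (a * f z) \<le> cmod a * B"
    by (auto simp: norm_mult mult_left_mono)
  with scale show ?case by auto
next
  case (monomial \<alpha> k)
  then show ?case using norm_monomial[of _ \<alpha>] by (auto intro!: exI[of _ 1])
qed auto

lemma trig_homogeneous_L2: "trig_homogeneous k f \<Longrightarrow> f \<in> L2"
  using trig_homogeneous_bounded[of k f] by (auto intro!: bounded_imp_L2 AE_I2)

lemma pairing_defect_trig_homogeneous:
  assumes "trig_homogeneous 1 f" "h \<in> H2"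
  shows "pairing_defect h f = 0"
proof -
  have "k = 1 \<longrightarrow> pairing_defect h f = 0" if "trig_homogeneous k f" for k
    using that
  proof (induction rule: trig_homogeneous.induct)
    case (add k f g)
    have "h \<in> L2" using assms by (simp add: H2_def)
    then show ?case
      using add pairing_defect_add[OF trig_homogeneous_L2[OF add(1)] trig_homogeneous_L2[OF add(2)]] by simp
  qed (simp_all add: pairing_defect_scale pairing_defect_monomial assms(2), simp add: pairing_defect_def)
  then show ?thesis using assms by simp
qed

lemma pairing_defect_torus_homogeneous:
  assumes "torus_homogeneous 1 f" "h \<in> H2"
  shows "pairing_defect h f = 0"
proof -
  obtain g where g: "trig_homogeneous 1 g" "\<And>z. z \<in> space torus_haar \<Longrightarrow> f z = g z"
    using assms(1) by (auto simp: torus_homogeneous_def)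
  have "pairing_defect h f = pairing_defect h g"
    unfolding pairing_defect_def using g(2) by (simp cong: Bochner_Integration.integral_cong)
  then show ?thesis using pairing_defect_trig_homogeneous[OF g(1) assms(2)] by simp
qed

text \<open>Continuity in the uniform norm for fixed \<open>h\<close>, which lets the vanishing pass
  to uniform limits.\<close>

lemma norm_pairing_defect_le:
  fixes h :: "('d::finite \<Rightarrow> complex) \<Rightarrow> complex"
  assumes f: "f \<in> borel_measurable torus_haar" "\<And>z. z \<in> space torus_haar \<Longrightarrow> cmod (f z) \<le> B" and h: "h \<in> L2"
  shows "cmod (pairing_defect h f)
    \<le> B * ((LINT z|torus_haar. cmod (h z)) + (\<Sum>j\<in>UNIV. cmod (LINT z|torus_haar. z j * cnj (h z))))"
proof -
  have fL2: "f \<in> L2" using f by (auto intro!: bounded_imp_L2 AE_I2)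
  have "(\<lambda>_::'d \<Rightarrow> complex. 1 :: complex) \<in> L2" by (rule bounded_imp_L2[where B = 1]) auto
  from integrable_L2_mult[OF h this] have hi: "integrable torus_haar (\<lambda>z. cmod (h z))" by simp
  have 1: "cmod (LINT z|torus_haar. f z * cnj (h z)) \<le> B * (LINT z|torus_haar. cmod (h z))"
  proof -
    have "cmod (LINT z|torus_haar. f z * cnj (h z)) \<le> (LINT z|torus_haar. B * cmod (h z))"
      using hi f(2)
      by (intro order_trans[OF integral_norm_bound integral_mono] integrable_norm integrable_L2_mult fL2 h)
        (auto simp: norm_mult mult_right_mono)
    then show ?thesis by simp
  qed
  have 2: "cmod (LINT z|torus_haar. f z * cnj (z j)) \<le> B" for j
  proof -
    have "cmod (LINT z|torus_haar. f z * cnj (z j)) \<le> (LINT z|(torus_haar :: ('d \<Rightarrow> complex) measure). B)"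
      using f(2)
      by (intro order_trans[OF integral_norm_bound integral_mono] integrable_norm integrable_L2_mult fL2 coordinate_L2)
        (auto simp: norm_mult space_torus_haar)
    then show ?thesis by (simp add: torus.prob_space)
  qed
  have "cmod (pairing_defect h f) \<le> cmod (LINT z|torus_haar. f z * cnj (h z))
      + (\<Sum>j\<in>UNIV. cmod ((LINT z|torus_haar. f z * cnj (z j)) * (LINT z|torus_haar. z j * cnj (h z))))"
    unfolding pairing_defect_def by (rule order_trans[OF norm_triangle_ineq4 add_left_mono[OF norm_sum]])
  also have "\<dots> \<le> B * (LINT z|torus_haar. cmod (h z)) + (\<Sum>j\<in>UNIV. B * cmod (LINT z|torus_haar. z j * cnj (h z)))"
    unfolding norm_mult by (intro add_mono 1 sum_mono mult_right_mono 2) auto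
  finally show ?thesis by (simp add: distrib_left sum_distrib_left)
qed

text \<open>The Weierstrass theorem approximates \<open>x powr (q / 2)\<close> on
  \<open>{0..M\<^sup>2}\<close> within \<open>e\<close> by a polynomial \<open>g\<close>. Then
  \<open>T\<close>, which is g(|phi|^2) phi, is homogeneous of degree 1, has zero defect, and is
  within \<open>e * M\<close> of \<open>pow_dir q\<close> of the form.\<close>

lemma pairing_defect_pow_dir:
  assumes "0 < q" and h: "h \<in> H2"
  shows "pairing_defect h (\<lambda>z. pow_dir q (linear_form c z)) = 0"
proof -
  define M where "M = (\<Sum>j\<in>UNIV. cmod (c j))"
  define C where "C = (LINT z|torus_haar. cmod (h z)) + (\<Sum>j\<in>UNIV. cmod (LINT z|torus_haar. z j * cnj (h z)))"
  have "0 \<le> M" "0 \<le> C" by (simp_all add: M_def C_def sum_nonneg)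
  have hL2: "h \<in> L2" using h by (simp add: H2_def)
  have FL2: "(\<lambda>z. pow_dir q (linear_form c z)) \<in> L2"
    by (rule bounded_imp_L2[OF _ AE_I2[OF norm_pow_dir_le[OF _ norm_linear_form_le]]]) (use assms in simp_all)
  have le: "cmod (pairing_defect h (\<lambda>z. pow_dir q (linear_form c z))) \<le> e * M * C" if e: "0 < e" for e
  proof -
    obtain g where g: "real_polynomial_function g" "\<And>x. x \<in> {0..M\<^sup>2} \<Longrightarrow> \<bar>x powr (q / 2) - g x\<bar> < e"
    proof (rule Stone_Weierstrass_real_polynomial_function[of "{0..M\<^sup>2}" "\<lambda>x. x powr (q / 2)" e])
      show "continuous_on {0..M\<^sup>2} (\<lambda>x. x powr (q / 2))"
        using assms(1) by (intro continuous_on_powr' continuous_intros) auto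
    qed (use e in auto)
    obtain a n where a: "g = (\<lambda>x. \<Sum>i\<le>n. a i * x ^ i)"
      using g(1) by (auto simp: real_polynomial_function_iff_sum)
    define T where "T z = of_real (g ((cmod (linear_form c z))\<^sup>2)) * linear_form c z" for z
    have "T = (\<lambda>z. \<Sum>i\<le>n. of_real (a i) * (of_real ((cmod (linear_form c z))\<^sup>2) ^ i * linear_form c z))"
      by (simp add: T_def[abs_def] a sum_distrib_right mult.assoc)
    then have T_hom: "torus_homogeneous 1 T"
      by (simp only:) (intro torus_homogeneous_sum torus_homogeneous_scale torus_homogeneous_norm_power finite_atMost)
    have [measurable]: "g \<in> borel_measurable borel"
      unfolding a by measurable
    have [measurable]: "T \<in> borel_measurable torus_haar"
      unfolding T_def[abs_def] by measurable
    have close: "cmod (pow_dir q (linear_form c z) - T z) \<le> e * M" if "z \<in> space torus_haar" for z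
    proof -
      let ?x = "cmod (linear_form c z)"
      have x: "?x \<le> M" unfolding M_def by (rule norm_linear_form_le[OF that])
      have "?x powr q = (?x\<^sup>2) powr (q / 2)"
        by (cases "linear_form c z = 0") (simp_all add: powr_powr flip: powr_numeral)
      then have "pow_dir q (linear_form c z) - T z = of_real ((?x\<^sup>2) powr (q / 2) - g (?x\<^sup>2)) * linear_form c z"
        by (simp add: pow_dir_def T_def left_diff_distrib)
      then have "cmod (pow_dir q (linear_form c z) - T z) = \<bar>(?x\<^sup>2) powr (q / 2) - g (?x\<^sup>2)\<bar> * ?x"
        by (simp only: norm_mult norm_of_real)
      also have "\<dots> \<le> e * M"
        using g(2)[of "?x\<^sup>2"] x power_mono[OF x, of 2] \<open>0 < e\<close> by (intro mult_mono) auto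
      finally show ?thesis .
    qed
    have TL2: "T \<in> L2"
    proof (rule bounded_imp_L2[OF _ AE_I2])
      fix z :: "'a \<Rightarrow> complex" assume z: "z \<in> space torus_haar"
      have "cmod (T z) \<le> cmod (pow_dir q (linear_form c z)) + cmod (pow_dir q (linear_form c z) - T z)"
        using norm_triangle_ineq4[of "pow_dir q (linear_form c z)" "pow_dir q (linear_form c z) - T z"] by simp
      also have "\<dots> \<le> M powr q * M + e * M"
        using norm_linear_form_le[OF z, of c] assms(1)
        by (intro add_mono close[OF z] norm_pow_dir_le) (simp_all add: M_def)
      finally show "cmod (T z) \<le> M powr q * M + e * M" .
    qed simp
    have "pairing_defect h (\<lambda>z. pow_dir q (linear_form c z))
        = pairing_defect h (\<lambda>z. pow_dir q (linear_form c z) - T z)"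
      using pairing_defect_diff[OF FL2 TL2 hL2] pairing_defect_torus_homogeneous[OF T_hom h] by simp
    then show ?thesis
      using norm_pairing_defect_le[OF _ close hL2] by (simp add: C_def)
  qed
  have "cmod (pairing_defect h (\<lambda>z. pow_dir q (linear_form c z))) \<le> 0"
  proof (rule field_le_epsilon)
    fix e :: real assume "0 < e"
    \<comment> \<open>The summand 1 keeps the denominator positive when
      \<open>M * C = 0\<close>.\<close>
    have "e / (M * C + 1) * M * C \<le> e"
      using \<open>0 < e\<close> mult_nonneg_nonneg[OF \<open>0 \<le> M\<close> \<open>0 \<le> C\<close>] by (simp add: field_simps)
    moreover have "0 < e / (M * C + 1)"
      using \<open>0 < e\<close> mult_nonneg_nonneg[OF \<open>0 \<le> M\<close> \<open>0 \<le> C\<close>] by (simp add: add_nonneg_pos)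
    ultimately show "cmod (pairing_defect h (\<lambda>z. pow_dir q (linear_form c z))) \<le> 0 + e"
      using le by fastforce
  qed
  then show ?thesis by simp
qed

text \<open>The representative picked by \<open>SOME\<close> is unknown. Its difference
  \<open>k\<close> from \<open>g\<close> lies in \<open>H2\<close>, and subtracting the two
  orthogonality relations tested against \<open>k\<close> shows that \<open>k\<close> has norm zero;
  hence equality holds almost everywhere.\<close>

lemma riesz_projection_unique:
  fixes f g :: "('d::finite \<Rightarrow> complex) \<Rightarrow> complex"
  assumes f: "f \<in> L2" and g: "g \<in> H2" and orth: "\<And>h. h \<in> H2 \<Longrightarrow> L2_inner (\<lambda>z. f z - g z) h = 0"
  shows "riesz_projection f \<in> H2" and "AE z in torus_haar. riesz_projection f z = g z"
proof -
  define u where "u = riesz_projection f"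
  have u: "u \<in> H2 \<and> (\<forall>h\<in>H2. L2_inner (\<lambda>z. f z - u z) h = 0)"
    unfolding u_def riesz_projection_def by (rule someI[of _ g]) (use g orth in auto)
  then show "riesz_projection f \<in> H2" by (simp add: u_def)
  define k where "k = (\<lambda>z. u z - g z)"
  have k: "k \<in> H2" unfolding k_def by (rule H2_diff) (use u g in auto)
  have L2: "u \<in> L2" "g \<in> L2" "k \<in> L2" using u g k by (auto simp: H2_def)
  have "L2_inner (\<lambda>z. f z - g z) k - L2_inner (\<lambda>z. f z - u z) k
      = (LINT z|torus_haar. (f z - g z) * cnj (k z) - (f z - u z) * cnj (k z))"
    unfolding L2_inner_def
    by (intro Bochner_Integration.integral_diff[symmetric] integrable_L2_mult L2_diff L2 f)
  also have "\<dots> = (LINT z|torus_haar. of_real ((cmod (k z))\<^sup>2))"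
    by (intro Bochner_Integration.integral_cong refl, simp only: complex_norm_square)
      (simp add: k_def algebra_simps)
  also have "\<dots> = of_real (LINT z|torus_haar. (cmod (k z))\<^sup>2)"
    by (rule integral_complex_of_real)
  finally have "complex_of_real (LINT z|torus_haar. (cmod (k z))\<^sup>2) = 0"
    using orth[OF k] u k by simp
  then have "AE z in torus_haar. (cmod (k z))\<^sup>2 = 0"
    using integral_nonneg_eq_0_iff_AE[of torus_haar "\<lambda>z. (cmod (k z))\<^sup>2"] L2(3) by (simp add: L2_def)
  then show "AE z in torus_haar. riesz_projection f z = g z"
    by eventually_elim (simp add: k_def u_def)
qed

text \<open>The vanishing of \<open>pairing_defect\<close> is the orthogonality that characterises
  the projection. \<open>f\<close> is given only up to null sets because the iterates of
  \<open>P_op\<close> are known only in that sense.\<close>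

lemma riesz_projection_pow_dir:
  fixes f :: "('d::finite \<Rightarrow> complex) \<Rightarrow> complex"
  assumes "0 < q" and [measurable]: "f \<in> borel_measurable torus_haar"
    and ae: "AE z in torus_haar. f z = pow_dir q (linear_form c z)"
  shows "riesz_projection f \<in> H2"
    and "AE z in torus_haar. riesz_projection f z = linear_form (pow_coeff q c) z"
proof -
  let ?M = "\<Sum>j\<in>UNIV. cmod (c j)" and ?F = "\<lambda>z. pow_dir q (linear_form c z)"
  have bound: "cmod (?F z) \<le> ?M powr q * ?M" if "z \<in> space torus_haar" for z
    using assms(1) by (intro norm_pow_dir_le norm_linear_form_le that) simp
  have FL2: "?F \<in> L2" by (rule bounded_imp_L2[OF _ AE_I2[OF bound]]) simp_all
  have fL2: "f \<in> L2"
  proof (rule bounded_imp_L2)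
    show "AE z in torus_haar. cmod (f z) \<le> ?M powr q * ?M"
      using ae AE_space by eventually_elim (use bound in simp)
  qed simp
  have "L2_inner (\<lambda>z. f z - linear_form (pow_coeff q c) z) h = 0" if h: "h \<in> H2" for h
  proof -
    have hL2: "h \<in> L2" using h by (simp add: H2_def)
    have [measurable]: "h \<in> borel_measurable torus_haar" using hL2 by (simp add: L2_def)
    have "L2_inner (\<lambda>z. f z - linear_form (pow_coeff q c) z) h
        = (LINT z|torus_haar. (?F z - linear_form (pow_coeff q c) z) * cnj (h z))"
      unfolding L2_inner_def by (rule integral_cong_AE) (use ae in \<open>auto simp: elim: eventually_mono\<close>)
    also have "\<dots> = (LINT z|torus_haar. ?F z * cnj (h z)) - (LINT z|torus_haar. linear_form (pow_coeff q c) z * cnj (h z))"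
      unfolding left_diff_distrib
      by (intro Bochner_Integration.integral_diff integrable_L2_mult FL2 hL2 linear_form_L2)
    also have "(LINT z|torus_haar. linear_form (pow_coeff q c) z * cnj (h z))
        = (LINT z|torus_haar. (\<Sum>j\<in>UNIV. pow_coeff q c j * (z j * cnj (h z))))"
      by (simp add: linear_form_def sum_distrib_right mult.assoc)
    also have "\<dots> = (\<Sum>j\<in>UNIV. pow_coeff q c j * (LINT z|torus_haar. z j * cnj (h z)))"
      using integrable_L2_mult[OF coordinate_L2 hL2] by simp
    also have "(LINT z|torus_haar. ?F z * cnj (h z)) - \<dots> = pairing_defect h ?F"
      by (simp add: pairing_defect_def pow_coeff_def)
    also have "\<dots> = 0" by (rule pairing_defect_pow_dir[OF assms(1) h])
    finally show ?thesis .
  qed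
  note orth = this
  show "riesz_projection f \<in> H2"
    by (rule riesz_projection_unique(1)[OF fL2 linear_form_H2 orth])
  show "AE z in torus_haar. riesz_projection f z = linear_form (pow_coeff q c) z"
    by (rule riesz_projection_unique(2)[OF fL2 linear_form_H2 orth])
qed

subsection \<open>Convergence of the iteration\<close>

lemma L2_norm_cong_AE:
  assumes "f \<in> borel_measurable torus_haar" "g \<in> borel_measurable torus_haar"
    and "AE z in torus_haar. f z = g z"
  shows "L2_norm f = L2_norm g"
proof -
  note [measurable] = assms(1,2)
  have "(LINT z|torus_haar. (cmod (f z))\<^sup>2) = (LINT z|torus_haar. (cmod (g z))\<^sup>2)"
    by (rule integral_cong_AE) (use assms(3) in \<open>auto elim: eventually_mono\<close>)
  then show ?thesis by (simp add: L2_norm_def)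
qed

lemma L2_norm_linear_form_unit:
  assumes "\<And>j. cmod (u j) = 1"
  shows "L2_norm (linear_form (\<lambda>j. u j * of_real (r j))) = sqrt (\<Sum>j\<in>UNIV. (r j)\<^sup>2)"
  by (simp add: L2_norm_linear_form norm_mult assms)

text \<open>One step of the iteration in polar coordinates: the phases \<open>u\<close> persist.
  Measurability accompanies the formula so that the conclusions can serve as hypotheses of the next
  step.\<close>

lemma P_op_linear_form:
  fixes f :: "('d::finite \<Rightarrow> complex) \<Rightarrow> complex"
  assumes "2 < p" and f[measurable]: "f \<in> borel_measurable torus_haar" and u: "\<And>j. cmod (u j) = 1"
    and ae: "AE z in torus_haar. f z = linear_form (\<lambda>j. u j * of_real (r j)) z"
  shows "P_op p f \<in> borel_measurable torus_haar"
    and "AE z in torus_haar. P_op p f z = linear_form (\<lambda>j. u j *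
      of_real (real_coeff (p - 2) r j / sqrt (\<Sum>i\<in>UNIV. (real_coeff (p - 2) r i)\<^sup>2))) z"
proof -
  define R where "R = riesz_projection (\<lambda>z. pow_dir (p - 2) (f z))"
  let ?a = "\<lambda>j. u j * of_real (real_coeff (p - 2) r j)"
  have P: "P_op p f = (\<lambda>z. R z / of_real (L2_norm R))"
    by (simp add: P_op_def R_def pow_dir_def Let_def)
  have "AE z in torus_haar. pow_dir (p - 2) (f z) = pow_dir (p - 2) (linear_form (\<lambda>j. u j * of_real (r j)) z)"
    using ae by eventually_elim simp
  note riesz = riesz_projection_pow_dir[OF _ _ this, folded R_def]
  have coeff: "pow_coeff (p - 2) (\<lambda>j. u j * of_real (r j)) = ?a"
    by (rule ext) (simp add: pow_coeff_rotate u pow_coeff_of_real)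
  have R_H2: "R \<in> H2" and R_ae: "AE z in torus_haar. R z = linear_form ?a z"
    using riesz assms(1) by (simp_all add: coeff)
  have [measurable]: "R \<in> borel_measurable torus_haar"
    using R_H2 by (simp add: H2_def L2_def)
  show "P_op p f \<in> borel_measurable torus_haar"
    unfolding P by measurable
  have norm: "L2_norm R = sqrt (\<Sum>i\<in>UNIV. (real_coeff (p - 2) r i)\<^sup>2)"
    using L2_norm_cong_AE[OF _ _ R_ae] L2_norm_linear_form_unit[of u, OF u] by simp
  show "AE z in torus_haar. P_op p f z = linear_form (\<lambda>j. u j *
      of_real (real_coeff (p - 2) r j / sqrt (\<Sum>i\<in>UNIV. (real_coeff (p - 2) r i)\<^sup>2))) z"
    using R_ae unfolding P norm by eventually_elim (simp add: linear_form_def sum_divide_distrib)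
qed

theorem theorem4p2:
  fixes p :: real
    and c :: "'d::finite \<Rightarrow> complex"
    and \<phi>\<^sub>0 :: "('d \<Rightarrow> complex) \<Rightarrow> complex"
  assumes "2 < p"
    and "\<phi>\<^sub>0 \<in> H2_1_sphere"
    and "AE z in torus_haar. \<phi>\<^sub>0 z = (\<Sum>j\<in>UNIV. c j * z j)"
    and "\<And>j. c j \<noteq> 0"
  shows "(\<lambda>n. L2_norm (\<lambda>z. (P_op p ^^ n) \<phi>\<^sub>0 z
            - 1 / of_real (sqrt (real CARD('d))) * (\<Sum>j\<in>UNIV. c j / of_real (cmod (c j)) * z j)))
         \<longlonglongrightarrow> 0"
proof -
  \<comment> \<open>\<open>u\<close> holds the phases, constant along the orbit, and
    \<open>x n\<close> the moduli of the coefficients of the n-th iterate, governed by the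
    normalized map \<open>N\<close>.\<close>
  define u where "u j = c j / of_real (cmod (c j))" for j
  define N where "N r j = real_coeff (p - 2) r j / sqrt (\<Sum>i\<in>UNIV. (real_coeff (p - 2) r i)\<^sup>2)"
    for r :: "'d \<Rightarrow> real" and j
  define x where "x n = (N ^^ n) (\<lambda>j. cmod (c j))" for n
  let ?s = "1 / sqrt (real CARD('d))"
  have u: "cmod (u j) = 1" for j
    using assms(4) by (simp add: u_def norm_divide)
  have c_eq: "c j = u j * of_real (cmod (c j))" for j
    using assms(4) by (simp add: u_def)
  have \<phi>_meas: "\<phi>\<^sub>0 \<in> borel_measurable torus_haar" and \<phi>_norm: "L2_norm \<phi>\<^sub>0 = 1"
    using assms(2) by (auto simp: H2_1_sphere_def H2_1_def H2_def L2_def)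
  have \<phi>_ae: "AE z in torus_haar. \<phi>\<^sub>0 z = linear_form c z"
    using assms(3) by (simp add: linear_form_def)
  have iter: "(P_op p ^^ n) \<phi>\<^sub>0 \<in> borel_measurable torus_haar \<and>
      (AE z in torus_haar. (P_op p ^^ n) \<phi>\<^sub>0 z = linear_form (\<lambda>j. u j * of_real (x n j)) z)" for n
  proof (induction n)
    case 0
    then show ?case using \<phi>_meas \<phi>_ae by (simp add: x_def flip: c_eq)
  next
    case (Suc n)
    then show ?case
      using P_op_linear_form[OF assms(1) conjunct1[OF Suc] u conjunct2[OF Suc]]
      by (simp add: x_def N_def)
  qed
  have x_lim: "(\<lambda>n. x n j) \<longlonglongrightarrow> ?s" for j
  proof (rule normalized_iteration_tendsto[where A = "real_coeff (p - 2)"])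
    show "(\<Sum>i\<in>UNIV. (x 0 i)\<^sup>2) = 1"
      using L2_norm_cong_AE[OF \<phi>_meas _ \<phi>_ae] by (simp add: x_def \<phi>_norm L2_norm_linear_form)
  qed (use assms in \<open>auto simp: x_def N_def intro: real_coeff_tendsto real_coeff_pos real_coeff_mono real_coeff_ratio\<close>)
  \<comment> \<open>Orthonormality of the coordinates and |u_j| = 1 reduce the distance to a
    Euclidean distance of moduli, a finite sum whose limit is taken termwise.\<close>
  have "L2_norm (\<lambda>z. (P_op p ^^ n) \<phi>\<^sub>0 z
            - 1 / of_real (sqrt (real CARD('d))) * (\<Sum>j\<in>UNIV. c j / of_real (cmod (c j)) * z j))
      = sqrt (\<Sum>j\<in>UNIV. (x n j - ?s)\<^sup>2)" for n
  proof -
    note [measurable] = conjunct1[OF iter[of n]]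
    let ?f = "\<lambda>z. (P_op p ^^ n) \<phi>\<^sub>0 z
      - 1 / of_real (sqrt (real CARD('d))) * (\<Sum>j\<in>UNIV. c j / of_real (cmod (c j)) * z j)"
    have "AE z in torus_haar. ?f z = linear_form (\<lambda>j. u j * of_real (x n j - ?s)) z"
      using conjunct2[OF iter[of n]]
      by eventually_elim
        (simp add: linear_form_def u_def sum_subtractf sum_distrib_left algebra_simps sum_divide_distrib)
    then have "L2_norm ?f = L2_norm (linear_form (\<lambda>j. u j * of_real (x n j - ?s)))"
      by (intro L2_norm_cong_AE) simp_all
    also have "\<dots> = sqrt (\<Sum>j\<in>UNIV. (x n j - ?s)\<^sup>2)"
      by (rule L2_norm_linear_form_unit[OF u])
    finally show ?thesis .
  qed
  moreover have "(\<lambda>n. sqrt (\<Sum>j\<in>UNIV. (x n j - ?s)\<^sup>2)) \<longlonglongrightarrow> sqrt (\<Sum>j\<in>(UNIV :: 'd set). (?s - ?s)\<^sup>2)"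
    by (intro tendsto_intros x_lim)
  ultimately show ?thesis by simp
qed

end
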